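(* Let $k$ be a number field, $\mathbf{G}$ a linear $k$--algebraic group, and $\mathbf{H}$ a closed $k$--algebraic subgroup of $\mathbf{G}$ such that every finite index subgroup of $\mathbf{H}(\mathcal{O}_k)$ is a congruence subgroup. Then a subgroup of $\mathbf{H}(\mathcal{O}_k)$ is separable in $\mathbf{H}(\mathcal{O}_k)$ if and only if it is separable in $\mathbf{G}(\mathcal{O}_k)$.
   Context: A linear $k$--algebraic group is a Zariski closed subgroup $\mathbf{G}\subseteq\mathrm{GL}(m;\bar k)$ whose ideal of vanishing is generated over $k$; for $\mathbf{H}\subseteq\mathbf{G}$ write $\mathbf{H}(\mathcal{O}_k)=\mathbf{H}\cap\mathrm{GL}(m;\mathcal{O}_k)$, where $\mathcal{O}_k$ is the ring of integers. For an ideal $\mathfrak{b}$ of $\mathcal{O}_k$, the kernel of the reduction map $\mathbf{H}(\mathcal{O}_k)\to\mathbf{H}(\mathcal{O}_k/\mathfrak{b})$ is a principal congruence subgroup; a congruence subgroup is a subgroup of $\mathbf{H}(\mathcal{O}_k)$ containing some principal congruence subgroup. A subgroup $H$ of a group $G$ is separable if for every $g\in G\setminus H$ there is a finite index subgroup of $G$ containing $H$ but not $g$. *)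

theory Defs
  imports "HOL-Analysis.Analysis" "HOL-Computational_Algebra.Polynomial"
    "HOL-Library.Poly_Mapping" "HOL-Algebra.Coset"
begin

section \<open>Number fields and rings of integers (inside the complex numbers)\<close>

definition is_subfield :: "complex set \<Rightarrow> bool" where
  "is_subfield k \<longleftrightarrow> 0 \<in> k \<and> 1 \<in> k \<and>
     (\<forall>x\<in>k. \<forall>y\<in>k. x + y \<in> k \<and> x * y \<in> k) \<and>
     (\<forall>x\<in>k. - x \<in> k \<and> inverse x \<in> k)"

text \<open>A number field: a subfield of the complex numbers that is a finite-dimensional
  vector space over the rationals.\<close>
definition number_field :: "complex set \<Rightarrow> bool" where
  "number_field k \<longleftrightarrow> is_subfield k \<and>
     (\<exists>B. finite B \<and> B \<subseteq> k \<and>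
        (\<forall>x\<in>k. \<exists>c :: complex \<Rightarrow> rat. x = (\<Sum>b\<in>B. of_rat (c b) * b)))"

definition algebraic_integer :: "complex \<Rightarrow> bool" where
  "algebraic_integer x \<longleftrightarrow>
     (\<exists>p :: int poly. lead_coeff p = 1 \<and> poly (map_poly of_int p) x = 0)"

definition ring_of_integers :: "complex set \<Rightarrow> complex set" where
  "ring_of_integers k = {x \<in> k. algebraic_integer x}"

text \<open>The algebraic closure of a number field, realised inside the complex numbers.\<close>
definition alg_closure :: "complex set" where
  "alg_closure = {x. algebraic x}"

text \<open>Ideals of a (sub)ring R of the complex numbers.\<close>
definition ring_ideal :: "complex set \<Rightarrow> complex set \<Rightarrow> bool" where
  "ring_ideal R b \<longleftrightarrow> b \<subseteq> R \<and> 0 \<in> b \<and>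
     (\<forall>x\<in>b. \<forall>y\<in>b. x + y \<in> b) \<and> (\<forall>x\<in>b. - x \<in> b) \<and>
     (\<forall>r\<in>R. \<forall>x\<in>b. r * x \<in> b)"

section \<open>Matrix groups\<close>

type_synonym 'n mat = "complex ^ 'n ^ 'n"

text \<open>\<open>GL(m; R)\<close> for a subring \<open>R\<close> of \<open>\<complex>\<close>: invertible matrices with
  entries in \<open>R\<close> whose inverse also has entries in \<open>R\<close>.\<close>
definition GL_over :: "complex set \<Rightarrow> 'n::finite mat set" where
  "GL_over R = {A. invertible A \<and> (\<forall>i j. A $ i $ j \<in> R) \<and>
                   (\<forall>i j. matrix_inv A $ i $ j \<in> R)}"

text \<open>Multivariate polynomials in the coordinates of \<open>GL(m)\<close> viewed as an affine variety:
  variables \<open>Some (i,j)\<close> for the entries \<open>x_ij\<close> and \<open>None\<close> for \<open>1/det\<close>.\<close>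
type_synonym 'n gl_poly = "(('n \<times> 'n) option \<Rightarrow>\<^sub>0 nat) \<Rightarrow>\<^sub>0 complex"

definition mpoly_eval :: "(('v \<Rightarrow>\<^sub>0 nat) \<Rightarrow>\<^sub>0 complex) \<Rightarrow> ('v \<Rightarrow> complex) \<Rightarrow> complex" where
  "mpoly_eval p a = (\<Sum>m\<in>Poly_Mapping.keys p. Poly_Mapping.lookup p m * (\<Prod>v\<in>Poly_Mapping.keys m. a v ^ Poly_Mapping.lookup m v))"

definition gl_coords :: "'n::finite mat \<Rightarrow> ('n \<times> 'n) option \<Rightarrow> complex" where
  "gl_coords A v = (case v of Some (i, j) \<Rightarrow> A $ i $ j | None \<Rightarrow> inverse (det A))"

definition gl_eval :: "'n::finite gl_poly \<Rightarrow> 'n mat \<Rightarrow> complex" where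
  "gl_eval p A = mpoly_eval p (gl_coords A)"

definition coeffs_in :: "complex set \<Rightarrow> (('v \<Rightarrow>\<^sub>0 nat) \<Rightarrow>\<^sub>0 complex) \<Rightarrow> bool" where
  "coeffs_in F p \<longleftrightarrow> (\<forall>m. Poly_Mapping.lookup p m \<in> F)"

text \<open>The ideal of \<open>F[x]\<close> generated by a set \<open>S\<close> of polynomials.\<close>
inductive_set poly_ideal_gen :: "complex set \<Rightarrow> (('v \<Rightarrow>\<^sub>0 nat) \<Rightarrow>\<^sub>0 complex) set
    \<Rightarrow> (('v \<Rightarrow>\<^sub>0 nat) \<Rightarrow>\<^sub>0 complex) set" for F S where
  zero: "0 \<in> poly_ideal_gen F S"
| gen: "p \<in> S \<Longrightarrow> coeffs_in F q \<Longrightarrow> q * p \<in> poly_ideal_gen F S"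
| add: "p \<in> poly_ideal_gen F S \<Longrightarrow> q \<in> poly_ideal_gen F S \<Longrightarrow> p + q \<in> poly_ideal_gen F S"

text \<open>The ideal of vanishing of a set of matrices in \<open>GL(m; \<bar>k\<close>), inside \<open>\<bar>k[GL(m)]\<close>.\<close>
definition vanishing_ideal :: "'n::finite mat set \<Rightarrow> 'n gl_poly set" where
  "vanishing_ideal G = {p. coeffs_in alg_closure p \<and> (\<forall>A\<in>G. gl_eval p A = 0)}"

definition zariski_closed_GL :: "'n::finite mat set \<Rightarrow> bool" where
  "zariski_closed_GL G \<longleftrightarrow> (\<exists>S. (\<forall>p\<in>S. coeffs_in alg_closure p) \<and>
      G = {A \<in> GL_over alg_closure. \<forall>p\<in>S. gl_eval p A = 0})"

definition matrix_subgroup :: "'n::finite mat set \<Rightarrow> 'n mat set \<Rightarrow> bool" where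
  "matrix_subgroup H G \<longleftrightarrow> H \<subseteq> G \<and> mat 1 \<in> H \<and>
     (\<forall>A\<in>H. \<forall>B\<in>H. A ** B \<in> H) \<and> (\<forall>A\<in>H. matrix_inv A \<in> H)"

text \<open>A linear \<open>k\<close>-algebraic group.\<close>
definition k_algebraic_group :: "complex set \<Rightarrow> 'n::finite mat set \<Rightarrow> bool" where
  "k_algebraic_group k G \<longleftrightarrow>
     matrix_subgroup G (GL_over alg_closure) \<and> zariski_closed_GL G \<and>
     (\<exists>S. (\<forall>p\<in>S. coeffs_in k p) \<and> vanishing_ideal G = poly_ideal_gen alg_closure S)"

text \<open>\<open>H(O_k) = H \<inter> GL(m; O_k)\<close>.\<close>
definition int_points :: "complex set \<Rightarrow> 'n::finite mat set \<Rightarrow> 'n mat set" where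
  "int_points k H = H \<inter> GL_over (ring_of_integers k)"

text \<open>Kernel of reduction \<open>H(O_k) \<rightarrow> H(O_k/b)\<close>: matrices congruent to the identity mod \<open>b\<close>.\<close>
definition principal_congruence :: "complex set \<Rightarrow> 'n::finite mat set \<Rightarrow> complex set \<Rightarrow> 'n mat set" where
  "principal_congruence k H b = {A \<in> int_points k H. \<forall>i j. (A - mat 1) $ i $ j \<in> b}"

definition matgrp :: "'n::finite mat set \<Rightarrow> 'n mat monoid" where
  "matgrp \<Gamma> = \<lparr>carrier = \<Gamma>, mult = (**), one = mat 1\<rparr>"

definition finite_index_subgroup :: "'n::finite mat set \<Rightarrow> 'n mat set \<Rightarrow> bool" where
  "finite_index_subgroup K \<Gamma> \<longleftrightarrow> subgroup K (matgrp \<Gamma>) \<and> finite (rcosets\<^bsub>matgrp \<Gamma>\<^esub> K)"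

definition congruence_subgroup :: "complex set \<Rightarrow> 'n::finite mat set \<Rightarrow> 'n mat set \<Rightarrow> bool" where
  "congruence_subgroup k H K \<longleftrightarrow> subgroup K (matgrp (int_points k H)) \<and>
     (\<exists>b. ring_ideal (ring_of_integers k) b \<and> b \<noteq> {0} \<and> principal_congruence k H b \<subseteq> K)"

definition separable_in :: "'n::finite mat set \<Rightarrow> 'n mat set \<Rightarrow> bool" where
  "separable_in L \<Gamma> \<longleftrightarrow> (\<forall>g\<in>\<Gamma> - L. \<exists>K. finite_index_subgroup K \<Gamma> \<and> L \<subseteq> K \<and> g \<notin> K)"

end

(* The nontrivial direction: let L be separable in H(O_k) and let g in G(O_k) lie outside L.
   It suffices to find n > 0 and a subgroup K of H(O_k) containing L such that no element of K
   is congruent to g modulo n: since O_k / n O_k is finite, the elements of G(O_k) congruent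
   modulo n to an element of K form a finite index subgroup.
   If g is in H, take K of finite index in H(O_k) separating g from L; it contains a principal
   congruence subgroup, whose level contains a positive integer n.
   If g is not in H, take K = L; some polynomial p with coefficients in k vanishes on H but not
   at g, and after clearing denominators any n not dividing p(g) in O_k works.

   That O_k is a ring, and that O_k / n O_k is finite, are both obtained by induction on the
   number of generators, because subgroups of the integers are cyclic and finitely generated
   subgroups of the rationals are cyclic. *)

theory Submission
  imports Defs
begin

section \<open>Additive subgroups of the complex numbers\<close>

text \<open>A finite index subgroup of H(O_k) need not come from one of G(O_k), and this is the
  obstacle in passing to the larger group. A congruence modulo n concerns matrix entries alone and
  so makes sense in G(O_k) too; that is why the congruence hypothesis on \<open>H\<close> helps.

  Nonzero ideals are replaced by the ideals n O_k because the quotients by these can be studied in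
  the additive group of O_k. Of that group one uses only that it lies in a finite-dimensional
  rational vector space. Its leading coordinates form a subgroup of the rationals that is not known
  to be finitely generated (a priori it might be Z[1/2]), but modulo n any such subgroup still has
  at most n classes. No integral basis, trace or norm enters: a nonzero algebraic integer divides
  the nonzero constant term of an integer polynomial, which takes the place of the norm.

  For g outside \<open>H\<close> the separating polynomial must have coefficients in k, and not just
  in the algebraic closure, so that its scaled value at g lies in O_k.\<close>

definition add_subgroup :: "complex set \<Rightarrow> bool" where
  "add_subgroup A \<longleftrightarrow> 0 \<in> A \<and> (\<forall>x\<in>A. \<forall>y\<in>A. x - y \<in> A)"

lemma add_subgroup_zero: "add_subgroup A \<Longrightarrow> 0 \<in> A"
  by (simp add: add_subgroup_def)

lemma add_subgroup_diff: "add_subgroup A \<Longrightarrow> x \<in> A \<Longrightarrow> y \<in> A \<Longrightarrow> x - y \<in> A"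
  by (simp add: add_subgroup_def)

lemma add_subgroup_uminus: "add_subgroup A \<Longrightarrow> x \<in> A \<Longrightarrow> - x \<in> A"
  using add_subgroup_diff[of A 0 x] by (simp add: add_subgroup_def)

lemma add_subgroup_add: "add_subgroup A \<Longrightarrow> x \<in> A \<Longrightarrow> y \<in> A \<Longrightarrow> x + y \<in> A"
  using add_subgroup_diff[of A x "- y"] add_subgroup_uminus by simp

lemma add_subgroup_of_nat_mult: "add_subgroup A \<Longrightarrow> x \<in> A \<Longrightarrow> of_nat n * x \<in> A"
  by (induction n) (auto simp: algebra_simps intro: add_subgroup_zero add_subgroup_add)

lemma add_subgroup_of_int_mult: "add_subgroup A \<Longrightarrow> x \<in> A \<Longrightarrow> of_int n * x \<in> A"
  by (cases n rule: int_cases2)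
    (auto intro: add_subgroup_of_nat_mult add_subgroup_uminus)

lemma add_subgroup_sum:
  "add_subgroup A \<Longrightarrow> (\<And>i. i \<in> S \<Longrightarrow> f i \<in> A) \<Longrightarrow> sum f S \<in> A"
  by (induction S rule: infinite_finite_induct) (auto intro: add_subgroup_zero add_subgroup_add)

lemma add_subgroup_Int: "add_subgroup A \<Longrightarrow> add_subgroup B \<Longrightarrow> add_subgroup (A \<inter> B)"
  by (simp add: add_subgroup_def)

lemma add_subgroup_Ints: "add_subgroup \<int>"
  by (simp add: add_subgroup_def)

lemma add_subgroup_Rats: "add_subgroup \<rat>"
  by (simp add: add_subgroup_def)

section \<open>Spans over \<open>\<int>\<close> and \<open>\<rat>\<close>, and coordinates along one
  generator\<close>

definition lin_span :: "complex set \<Rightarrow> complex set \<Rightarrow> complex set" where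
  "lin_span R B = {x. \<exists>c. (\<forall>b\<in>B. c b \<in> R) \<and> x = (\<Sum>b\<in>B. c b * b)}"

lemma lin_span_empty: "lin_span R {} = {0}"
  by (simp add: lin_span_def)

lemma lin_span_insert:
  assumes "finite B" "b \<notin> B"
  shows "lin_span R (insert b B) = {c * b + s | c s. c \<in> R \<and> s \<in> lin_span R B}"
proof (intro equalityI subsetI)
  fix x assume "x \<in> lin_span R (insert b B)"
  then show "x \<in> {c * b + s | c s. c \<in> R \<and> s \<in> lin_span R B}"
    using assms unfolding lin_span_def by auto
next
  fix x assume "x \<in> {c * b + s | c s. c \<in> R \<and> s \<in> lin_span R B}"
  then obtain c d where cd: "c \<in> R" "\<forall>b\<in>B. d b \<in> R" "x = c * b + (\<Sum>b\<in>B. d b * b)"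
    unfolding lin_span_def by auto
  have "(\<Sum>a\<in>B. (d(b := c)) a * a) = (\<Sum>a\<in>B. d a * a)"
    using assms by (intro sum.cong) auto
  then have "x = (\<Sum>a\<in>insert b B. (d(b := c)) a * a)"
    using assms cd by simp
  moreover have "\<forall>a\<in>insert b B. (d(b := c)) a \<in> R"
    using cd by simp
  ultimately show "x \<in> lin_span R (insert b B)"
    unfolding lin_span_def by blast
qed

lemma add_subgroup_lin_span:
  assumes "add_subgroup R"
  shows "add_subgroup (lin_span R B)"
proof -
  have "0 \<in> lin_span R B"
    unfolding lin_span_def using assms by (auto intro!: exI[of _ "\<lambda>_. 0"] add_subgroup_zero)
  moreover have "x - y \<in> lin_span R B" if "x \<in> lin_span R B" "y \<in> lin_span R B" for x y
  proof -
    obtain c d where "\<forall>b\<in>B. c b \<in> R" "x = (\<Sum>b\<in>B. c b * b)"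
      "\<forall>b\<in>B. d b \<in> R" "y = (\<Sum>b\<in>B. d b * b)"
      using \<open>x \<in> _\<close> \<open>y \<in> _\<close> unfolding lin_span_def by auto
    then show ?thesis
      unfolding lin_span_def using assms
      by (auto intro!: exI[of _ "\<lambda>b. c b - d b"] add_subgroup_diff
          simp: sum_subtractf left_diff_distrib)
  qed
  ultimately show ?thesis by (simp add: add_subgroup_def)
qed

lemma lin_span_base:
  assumes "add_subgroup R" "1 \<in> R" "finite B" "b \<in> B"
  shows "b \<in> lin_span R B"
proof -
  have "(\<Sum>a\<in>B. (if a = b then 1 else 0) * a) = (\<Sum>a\<in>B. if a = b then b else 0)"
    by (intro sum.cong) auto
  then have "b = (\<Sum>a\<in>B. (if a = b then 1 else 0) * a)"
    using assms by simp
  moreover have "\<forall>a\<in>B. (if a = b then 1 else 0) \<in> R"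
    using assms by (auto intro: add_subgroup_zero)
  ultimately show ?thesis
    unfolding lin_span_def by (intro CollectI exI[of _ "\<lambda>a. if a = b then 1 else 0"]) blast
qed

lemma lin_span_Ints_subset:
  assumes "add_subgroup A" "B \<subseteq> A"
  shows "lin_span \<int> B \<subseteq> A"
proof
  fix x assume "x \<in> lin_span \<int> B"
  then obtain c where c: "\<forall>b\<in>B. c b \<in> \<int>" "x = (\<Sum>b\<in>B. c b * b)"
    unfolding lin_span_def by auto
  have "c b * b \<in> A" if "b \<in> B" for b
    using c(1) that assms by (auto elim!: Ints_cases intro!: add_subgroup_of_int_mult dest!: bspec)
  then show "x \<in> A" unfolding c(2) by (intro add_subgroup_sum assms)
qed

text \<open>\<open>b\<close> and \<open>B\<close> may be linearly dependent, so the coordinate along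
  \<open>b\<close> is not a function of the element. Collecting all possible coordinates avoids the
  choice of a basis; the elements of \<open>A\<close> that admit the coordinate 0 are those in
  \<open>lin_span R B\<close>.\<close>

definition lead_coords :: "complex set \<Rightarrow> complex set \<Rightarrow> complex \<Rightarrow> complex set \<Rightarrow> complex set" where
  "lead_coords R A b B = {c \<in> R. \<exists>s\<in>lin_span R B. c * b + s \<in> A}"

lemma add_subgroup_lead_coords:
  assumes "add_subgroup R" "add_subgroup A"
  shows "add_subgroup (lead_coords R A b B)"
proof -
  have "0 \<in> lead_coords R A b B"
    using assms add_subgroup_lin_span[OF assms(1), of B]
    by (auto simp: lead_coords_def intro: add_subgroup_zero bexI[of _ 0])
  moreover have "x - y \<in> lead_coords R A b B"
    if xy: "x \<in> lead_coords R A b B" "y \<in> lead_coords R A b B" for x y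
  proof -
    from xy obtain s t where st: "s \<in> lin_span R B" "t \<in> lin_span R B" "x \<in> R" "y \<in> R"
      "x * b + s \<in> A" "y * b + t \<in> A"
      by (auto simp: lead_coords_def)
    have "(x * b + s) - (y * b + t) = (x - y) * b + (s - t)"
      by (simp add: algebra_simps)
    then show ?thesis
      using add_subgroup_diff[OF assms(1) st(3,4)] add_subgroup_diff[OF assms(2) st(5,6)]
        add_subgroup_diff[OF add_subgroup_lin_span[OF assms(1)] st(1,2)]
      unfolding lead_coords_def by (metis (mono_tags, lifting) mem_Collect_eq)
  qed
  ultimately show ?thesis by (simp add: add_subgroup_def)
qed

section \<open>Subgroups of finitely generated groups\<close>

lemma Ints_subgroup_principal:
  assumes "add_subgroup C" "C \<subseteq> \<int>"
  shows "\<exists>c\<in>C. \<forall>x\<in>C. \<exists>m::int. x = of_int m * c"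
proof (cases "C \<subseteq> {0}")
  case True
  then show ?thesis using add_subgroup_zero[OF assms(1)] by (intro bexI[of _ 0]) auto
next
  case False
  then obtain x where x: "x \<in> C" "x \<noteq> 0" by auto
  obtain i where i: "x = of_int i" using x assms by (auto elim: Ints_cases)
  define P where "P n \<longleftrightarrow> n > 0 \<and> (of_nat n :: complex) \<in> C" for n
  have "(of_nat (nat \<bar>i\<bar>) :: complex) = x \<or> (of_nat (nat \<bar>i\<bar>) :: complex) = - x"
    using i by (auto simp: abs_if)
  then have "P (nat \<bar>i\<bar>)"
    using x i add_subgroup_uminus[OF assms(1), of x] by (auto simp: P_def)
  define g where "g = (LEAST n. P n)"
  have g: "P g" and least: "\<And>n. P n \<Longrightarrow> g \<le> n"
    unfolding g_def using \<open>P (nat \<bar>i\<bar>)\<close> by (auto intro: LeastI Least_le)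
  have "\<exists>m::int. y = of_int m * of_nat g" if "y \<in> C" for y
  proof -
    obtain j where j: "y = of_int j" using \<open>y \<in> C\<close> assms(2) by (blast elim: Ints_cases)
    \<comment> \<open>Division with remainder: \<open>r\<close> lies in \<open>C\<close> and is
      smaller than its least positive element \<open>g\<close>, hence is zero.\<close>
    define r where "r = j mod int g"
    have r: "r \<ge> 0" "r < int g" using g by (auto simp: r_def P_def)
    have "j = (j div int g) * int g + r" by (simp add: r_def)
    then have yr: "y = of_int (j div int g) * of_nat g + of_int r"
      unfolding j by (metis of_int_add of_int_mult of_int_of_nat_eq)
    then have "of_int r = y - of_int (j div int g) * of_nat g" by simp
    also have "\<dots> \<in> C"
      using g that by (intro add_subgroup_diff add_subgroup_of_int_mult assms) (auto simp: P_def)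
    finally have rC: "(of_nat (nat r) :: complex) \<in> C" using r by simp
    have "r = 0"
    proof (rule ccontr)
      assume "r \<noteq> 0"
      then have "P (nat r)" using r rC by (simp add: P_def)
      from least[OF this] r show False by simp
    qed
    with yr show ?thesis by auto
  qed
  then show ?thesis using g by (auto simp: P_def)
qed

text \<open>Induction on the generators: the leading coordinates form a subgroup of \<open>\<int>\<close>, hence
  are the multiples of one of them, and subtracting multiples of an element realising it
  reduces the number of generators.\<close>
lemma finitely_generated_subgroup:
  assumes "finite B" "add_subgroup A" "A \<subseteq> lin_span \<int> B"
  shows "\<exists>F. finite F \<and> F \<subseteq> A \<and> A \<subseteq> lin_span \<int> F"
  using assms
proof (induction B arbitrary: A rule: finite_induct)
  case empty
  then show ?case by (intro exI[of _ "{}"]) auto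
next
  case (insert b B)
  note sp = add_subgroup_lin_span[OF add_subgroup_Ints]
  obtain c where c: "c \<in> lead_coords \<int> A b B"
    "\<And>x. x \<in> lead_coords \<int> A b B \<Longrightarrow> \<exists>m::int. x = of_int m * c"
    using Ints_subgroup_principal[OF add_subgroup_lead_coords[OF add_subgroup_Ints insert.prems(1)], of b B]
    by (auto simp: lead_coords_def)
  then obtain s where s: "s \<in> lin_span \<int> B" "c * b + s \<in> A" by (auto simp: lead_coords_def)
  obtain F where F: "finite F" "F \<subseteq> A \<inter> lin_span \<int> B" "A \<inter> lin_span \<int> B \<subseteq> lin_span \<int> F"
    using insert.IH[of "A \<inter> lin_span \<int> B"] add_subgroup_Int[OF insert.prems(1) sp] by auto
  define F' where "F' = insert (c * b + s) F"
  have base: "x \<in> lin_span \<int> F'" if "x \<in> F'" for x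
    using lin_span_base[OF add_subgroup_Ints] F(1) that by (simp add: F'_def)
  have FF: "lin_span \<int> F \<subseteq> lin_span \<int> F'"
    using base by (intro lin_span_Ints_subset[OF sp]) (simp add: F'_def subset_iff)
  have "x \<in> lin_span \<int> F'" if x: "x \<in> A" for x
  proof -
    obtain d t where dt: "d \<in> \<int>" "t \<in> lin_span \<int> B" "x = d * b + t"
      using x insert.prems(2) lin_span_insert[OF insert.hyps] by blast
    then have "d \<in> lead_coords \<int> A b B" using x by (auto simp: lead_coords_def)
    then obtain m :: int where m: "d = of_int m * c" using c(2) by blast
    have "x - of_int m * (c * b + s) = t - of_int m * s"
      by (simp add: dt m algebra_simps)
    then have "x - of_int m * (c * b + s) \<in> A \<inter> lin_span \<int> B"
      using add_subgroup_diff[OF insert.prems(1) x add_subgroup_of_int_mult[OF insert.prems(1) s(2)]]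
        add_subgroup_diff[OF sp dt(2) add_subgroup_of_int_mult[OF sp s(1)]]
      by (metis IntI)
    then have "x - of_int m * (c * b + s) \<in> lin_span \<int> F'" using F(3) FF by blast
    moreover have "of_int m * (c * b + s) \<in> lin_span \<int> F'"
      by (intro add_subgroup_of_int_mult[OF sp] base) (simp add: F'_def)
    ultimately show ?thesis using add_subgroup_add[OF sp] by fastforce
  qed
  then show ?case using F s by (intro exI[of _ F']) (auto simp: F'_def)
qed

section \<open>Subgroups of finite-dimensional rational spaces modulo n\<close>

lemma Rats_subgroup_cyclic_pair:
  assumes "add_subgroup C" "C \<subseteq> \<rat>" "x \<in> C" "y \<in> C"
  shows "\<exists>c\<in>C. (\<exists>m::int. x = of_int m * c) \<and> (\<exists>m::int. y = of_int m * c)"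
proof -
  obtain a b where ab: "b > 0" "x = of_int a / of_int b"
    using assms by (auto elim!: Rats_cases')
  obtain a' b' where ab': "b' > 0" "y = of_int a' / of_int b'"
    using assms by (auto elim!: Rats_cases')
  define u v where "u = a * b'" and "v = a' * b"
  have x: "x = of_int u / of_int (b * b')" and y: "y = of_int v / of_int (b * b')"
    using ab ab' by (auto simp: u_def v_def)
  \<comment> \<open>Over a common denominator, Bezout's identity turns the gcd of the numerators
    into an integer combination of \<open>x\<close> and \<open>y\<close>, so the common generator
    stays in \<open>C\<close>.\<close>
  obtain s t where st: "s * u + t * v = gcd u v" using bezout_int by blast
  define c where "c = of_int s * x + of_int t * y"
  have "c \<in> C" unfolding c_def by (intro add_subgroup_add add_subgroup_of_int_mult assms)
  have "c = of_int (s * u + t * v) / of_int (b * b')"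
    by (simp add: c_def x y add_divide_distrib)
  then have c: "c = of_int (gcd u v) / of_int (b * b')" using st by simp
  have "x = of_int (u div gcd u v) * c"
    unfolding c x times_divide_eq_right of_int_mult[symmetric] by simp
  moreover have "y = of_int (v div gcd u v) * c"
    unfolding c y times_divide_eq_right of_int_mult[symmetric] by simp
  ultimately show ?thesis using \<open>c \<in> C\<close> by blast
qed

lemma Rats_subgroup_locally_cyclic:
  assumes "add_subgroup C" "C \<subseteq> \<rat>" "finite S" "S \<subseteq> C"
  shows "\<exists>c\<in>C. \<forall>x\<in>S. \<exists>m::int. x = of_int m * c"
  using assms(3,4)
proof (induction S rule: finite_induct)
  case empty
  then show ?case using add_subgroup_zero[OF assms(1)] by auto
next
  case (insert y S)
  then obtain c where c: "c \<in> C" "\<And>x. x \<in> S \<Longrightarrow> \<exists>m::int. x = of_int m * c" by auto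
  obtain d m n where d: "d \<in> C" "c = of_int m * d" "y = of_int n * d"
    using Rats_subgroup_cyclic_pair[OF assms(1,2) c(1), of y] insert.prems by blast
  have "\<exists>m::int. x = of_int m * d" if "x \<in> S" for x
    using c(2)[OF that] d(2) by (metis mult.assoc of_int_mult)
  then show ?case using d by blast
qed

definition finite_quotient :: "complex set \<Rightarrow> nat \<Rightarrow> bool" where
  "finite_quotient A n \<longleftrightarrow>
     (\<exists>F. finite F \<and> F \<subseteq> A \<and> (\<forall>x\<in>A. \<exists>f\<in>F. \<exists>y\<in>A. x = f + of_nat n * y))"

text \<open>Finitely many elements of \<open>C\<close> lie in a cyclic subgroup, so more than \<open>n\<close> of them cannot
  be pairwise incongruent modulo \<open>n\<close>.\<close>
lemma Rats_subgroup_finite_quotient: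
  assumes C: "add_subgroup C" "C \<subseteq> \<rat>" and n: "n > 0"
  shows "finite_quotient C n"
proof -
  define cong where "cong x z \<longleftrightarrow> (\<exists>y\<in>C. x = z + of_nat n * y)" for x z :: complex
  define P where "P S \<longleftrightarrow> finite S \<and> S \<subseteq> C \<and> (\<forall>x\<in>S. \<forall>z\<in>S. x \<noteq> z \<longrightarrow> \<not> cong x z)" for S
  have bound: "card S \<le> n" if "P S" for S
  proof -
    obtain c where c: "c \<in> C" "\<forall>x\<in>S. \<exists>m::int. x = of_int m * c"
      using Rats_subgroup_locally_cyclic[OF C, of S] \<open>P S\<close> unfolding P_def by blast
    then obtain m where m: "\<And>x. x \<in> S \<Longrightarrow> x = of_int (m x) * c" by metis
    have "inj_on (\<lambda>x. m x mod int n) S"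
    proof (rule inj_onI, rule ccontr)
      fix x z assume xz: "x \<in> S" "z \<in> S" "m x mod int n = m z mod int n" "x \<noteq> z"
      then obtain q where "m x = m z + int n * q"
        by (metis mod_eqE)
      then have "x = z + of_nat n * (of_int q * c)"
        using m[OF xz(1)] m[OF xz(2)] by (simp add: algebra_simps)
      then have "cong x z"
        using c(1) add_subgroup_of_int_mult[OF C(1)] by (auto simp: cong_def)
      then show False using xz \<open>P S\<close> by (auto simp: P_def)
    qed
    moreover have "(\<lambda>x. m x mod int n) ` S \<subseteq> {0..<int n}" using n by auto
    ultimately have "card S \<le> card {0..<int n}" by (intro card_inj_on_le) auto
    then show ?thesis by simp
  qed
  have "P {}" by (simp add: P_def)
  \<comment> \<open>The size bound yields a pairwise incongruent set of maximal size. It represents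
    every class, since otherwise it could be enlarged.\<close>
  then obtain S where S: "P S" "\<And>T. P T \<Longrightarrow> card T \<le> card S"
    using ex_has_greatest_nat[of P "{}" card "Suc n"] bound by (metis le_imp_less_Suc)
  have "\<exists>f\<in>S. cong x f" if x: "x \<in> C" for x
  proof (cases "x \<in> S")
    case True
    then show ?thesis
      using add_subgroup_zero[OF C(1)] unfolding cong_def
      by (metis add.right_neutral mult_zero_right)
  next
    case False
    have "finite S" using \<open>P S\<close> by (simp add: P_def)
    then have "\<not> P (insert x S)" using S(2)[of "insert x S"] False by auto
    then obtain f where f: "f \<in> S" "cong x f \<or> cong f x"
      using \<open>P S\<close> x unfolding P_def by blast
    have "cong x f" if fx: "cong f x"
    proof -
      obtain y where y: "y \<in> C" "f = x + of_nat n * y" using fx by (auto simp: cong_def)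
      then have "x = f + of_nat n * (- y)" by simp
      then show ?thesis using add_subgroup_uminus[OF C(1) y(1)] unfolding cong_def by blast
    qed
    then show ?thesis using f by blast
  qed
  then show ?thesis using \<open>P S\<close> unfolding finite_quotient_def P_def cong_def by blast
qed

text \<open>Extension argument: representatives modulo n of the leading coordinates, lifted to
  \<open>A\<close>, are added to representatives for the part of \<open>A\<close> inside
  \<open>lin_span \<rat> B\<close>.\<close>

lemma finite_rank_finite_quotient:
  assumes "finite B" "add_subgroup A" "A \<subseteq> lin_span \<rat> B" "n > 0"
  shows "finite_quotient A n"
  using assms(1-3)
proof (induction B arbitrary: A rule: finite_induct)
  case empty
  then show ?case unfolding finite_quotient_def lin_span_empty
    by (intro exI[of _ "{0}"]) (use add_subgroup_zero[of A] in \<open>auto intro!: bexI[of _ 0]\<close>)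
next
  case (insert b B)
  note sp = add_subgroup_lin_span[OF add_subgroup_Rats]
  let ?C = "lead_coords \<rat> A b B" and ?A' = "A \<inter> lin_span \<rat> B"
  have "finite_quotient ?C n"
    using Rats_subgroup_finite_quotient[OF add_subgroup_lead_coords[OF add_subgroup_Rats insert.prems(1)]]
      assms(4) by (auto simp: lead_coords_def)
  then obtain E where E: "finite E" "E \<subseteq> ?C" "\<And>x. x \<in> ?C \<Longrightarrow> \<exists>f\<in>E. \<exists>y\<in>?C. x = f + of_nat n * y"
    unfolding finite_quotient_def by metis
  have "finite_quotient ?A' n"
    using insert.IH[of ?A'] add_subgroup_Int[OF insert.prems(1) sp] by auto
  then obtain F where F: "finite F" "F \<subseteq> ?A'" "\<And>x. x \<in> ?A' \<Longrightarrow> \<exists>f\<in>F. \<exists>y\<in>?A'. x = f + of_nat n * y"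
    unfolding finite_quotient_def by metis
  have "\<forall>c\<in>?C. \<exists>s. s \<in> lin_span \<rat> B \<and> c * b + s \<in> A" by (auto simp: lead_coords_def)
  then obtain \<sigma> where \<sigma>: "\<And>c. c \<in> ?C \<Longrightarrow> \<sigma> c \<in> lin_span \<rat> B" "\<And>c. c \<in> ?C \<Longrightarrow> c * b + \<sigma> c \<in> A"
    by metis
  define l where "l c = c * b + \<sigma> c" for c
  define D where "D = (\<lambda>(c, f). l c + f) ` (E \<times> F)"
  have "\<exists>f\<in>D. \<exists>y\<in>A. x = f + of_nat n * y" if x: "x \<in> A" for x
  proof -
    obtain d t where dt: "d \<in> \<rat>" "t \<in> lin_span \<rat> B" "x = d * b + t"
      using x insert.prems(2) lin_span_insert[OF insert.hyps] by blast
    then have "d \<in> ?C" using x by (auto simp: lead_coords_def)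
    then obtain e y where ey: "e \<in> E" "y \<in> ?C" "d = e + of_nat n * y" using E(3) by blast
    have eC: "e \<in> ?C" using ey E by blast
    \<comment> \<open>The choice \<open>\<sigma>\<close> need not be additive, so two lifts are
      subtracted separately. The coordinates along \<open>b\<close> cancel, and \<open>x'\<close>
      falls into the part covered by the induction hypothesis.\<close>
    define x' where "x' = x - l e - of_nat n * l y"
    have "x' \<in> A" unfolding x'_def l_def
      using \<sigma>(2)[OF eC] \<sigma>(2)[OF ey(2)] x insert.prems(1)
      by (intro add_subgroup_diff add_subgroup_of_nat_mult) auto
    moreover have "x' = t - \<sigma> e - of_nat n * \<sigma> y"
      by (simp add: x'_def l_def dt ey algebra_simps)
    then have "x' \<in> lin_span \<rat> B"
      using dt(2) \<sigma>(1)[OF eC] \<sigma>(1)[OF ey(2)]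
      by (simp add: add_subgroup_diff add_subgroup_of_nat_mult sp)
    ultimately obtain f z where fz: "f \<in> F" "z \<in> ?A'" "x' = f + of_nat n * z" using F(3) by blast
    then have "x = (l e + f) + of_nat n * (l y + z)" by (simp add: x'_def algebra_simps)
    moreover have "l e + f \<in> D" using ey fz by (auto simp: D_def)
    moreover have "l y + z \<in> A"
      using \<sigma>(2)[OF ey(2)] fz(2) by (auto simp: l_def intro: add_subgroup_add[OF insert.prems(1)])
    ultimately show ?thesis by blast
  qed
  moreover have "l e + f \<in> A" if "e \<in> E" "f \<in> F" for e f
    using that E(2) F(2) \<sigma>(2)
    by (intro add_subgroup_add[OF insert.prems(1)]) (auto simp: l_def)
  then have "finite D" "D \<subseteq> A"
    using E(1) F(1) by (auto simp: D_def)
  ultimately show ?case unfolding finite_quotient_def by blast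
qed

section \<open>Algebraic integers\<close>

lemma algebraic_integer_iff: "algebraic_integer x \<longleftrightarrow> algebraic_int x"
  by (auto simp: algebraic_integer_def algebraic_int_altdef_ipoly)

lemma poly_of_int_eq_sum:
  "poly (map_poly of_int p) (x::complex) = (\<Sum>i\<le>degree p. of_int (coeff p i) * x ^ i)"
  by (simp add: poly_altdef degree_map_poly coeff_map_poly)

lemma map_poly_of_int_add:
  "map_poly of_int (p + q) = (map_poly of_int p + map_poly of_int q :: complex poly)"
  by (rule poly_eqI) (simp add: coeff_map_poly)

lemma map_poly_of_int_diff:
  "map_poly of_int (p - q) = (map_poly of_int p - map_poly of_int q :: complex poly)"
  by (rule poly_eqI) (simp add: coeff_map_poly)

lemma map_poly_of_int_smult:
  "map_poly of_int (smult c p) = (smult (of_int c) (map_poly of_int p) :: complex poly)"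
  by (rule poly_eqI) (simp add: coeff_map_poly)

lemma map_poly_of_int_sum:
  "map_poly of_int (sum f S) = (\<Sum>i\<in>S. map_poly of_int (f i) :: complex poly)"
  by (induction S rule: infinite_finite_induct) (auto simp: map_poly_of_int_add)

text \<open>The subgroup \<open>\<int>[z]\<close> of \<open>lin_span \<int> B\<close> is finitely generated; if all generators are
  polynomials in \<open>z\<close> of degree less than \<open>N\<close>, then \<open>z ^ N\<close> is a combination of these.\<close>
lemma algebraic_int_of_finite_module:
  assumes "finite B" "1 \<in> lin_span \<int> B" "\<And>x. x \<in> lin_span \<int> B \<Longrightarrow> z * x \<in> lin_span \<int> B"
  shows "algebraic_int z"
proof -
  note sp = add_subgroup_lin_span[OF add_subgroup_Ints]
  define ev where "ev p = poly (map_poly of_int p) z" for p :: "int poly"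
  define A where "A = range ev"
  have "add_subgroup A"
    unfolding add_subgroup_def A_def
  proof (intro conjI ballI)
    have "ev 0 = 0" by (simp add: ev_def)
    then show "0 \<in> range ev" by (metis rangeI)
    fix x y assume "x \<in> range ev" "y \<in> range ev"
    then obtain p q where "x = ev p" "y = ev q" by auto
    then have "x - y = ev (p - q)" by (simp add: ev_def map_poly_of_int_diff)
    then show "x - y \<in> range ev" by auto
  qed
  have zpow: "z ^ i \<in> lin_span \<int> B" for i
    using assms by (induction i) auto
  have "A \<subseteq> lin_span \<int> B"
    unfolding A_def ev_def poly_of_int_eq_sum
    by (auto intro!: add_subgroup_sum[OF sp] add_subgroup_of_int_mult[OF sp] zpow)
  then obtain F where F: "finite F" "F \<subseteq> A" "A \<subseteq> lin_span \<int> F"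
    using finitely_generated_subgroup[OF assms(1) \<open>add_subgroup A\<close>] by blast
  have "\<forall>f\<in>F. \<exists>p. f = ev p" using F(2) by (auto simp: A_def)
  then obtain P where P: "\<And>f. f \<in> F \<Longrightarrow> f = ev (P f)" by metis
  \<comment> \<open>Each degree is at most the sum. \<open>Suc\<close> makes the inequality strict
    and \<open>N\<close> positive even if \<open>F\<close> is empty, as the degree bound for
    \<open>r\<close> requires.\<close>
  define N where "N = Suc (\<Sum>f\<in>F. degree (P f))"
  have degP: "degree (P f) < N" if "f \<in> F" for f
    using member_le_sum[of f F "\<lambda>f. degree (P f)"] F(1) that by (simp add: N_def)
  have "z ^ N = ev (monom 1 N)" by (simp add: ev_def map_poly_monom poly_monom)
  then have "z ^ N \<in> lin_span \<int> F" using F(3) by (auto simp: A_def)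
  then obtain c where c: "\<forall>f\<in>F. c f \<in> \<int>" "z ^ N = (\<Sum>f\<in>F. c f * f)"
    unfolding lin_span_def by auto
  have "\<forall>f\<in>F. \<exists>d. c f = of_int d" using c(1) by (auto elim: Ints_cases)
  then obtain d where d: "\<And>f. f \<in> F \<Longrightarrow> c f = of_int (d f)" by metis
  define r where "r = (\<Sum>f\<in>F. smult (d f) (P f))"
  have "ev r = (\<Sum>f\<in>F. of_int (d f) * ev (P f))"
    by (simp add: r_def ev_def map_poly_of_int_sum map_poly_of_int_smult poly_sum)
  also have "\<dots> = z ^ N" unfolding c(2) using P d by (intro sum.cong) auto
  finally have "ev (monom 1 N - r) = 0"
    by (simp add: ev_def map_poly_of_int_diff map_poly_monom poly_monom)
  moreover have "degree r < N"
    unfolding r_def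
    by (rule degree_sum_less) (use degP in \<open>auto simp: N_def intro: le_less_trans[OF degree_smult_le]\<close>)
  then have "degree (monom (1::int) N - r) = N" "coeff (monom 1 N - r) N = 1"
    using degree_add_eq_left[of "- r" "monom (1::int) N"]
    by (auto simp: degree_monom_eq coeff_eq_0)
  ultimately show ?thesis
    unfolding algebraic_int_altdef_ipoly ev_def by metis
qed

section \<open>Closure of the algebraic integers under ring operations\<close>

lemma algebraic_int_power_reduce:
  assumes "algebraic_int (x::complex)"
  obtains d c where "d > 0" "x ^ d = (\<Sum>i<d. of_int (c i) * x ^ i)"
proof -
  obtain p where p: "poly (map_poly of_int p) x = 0" "lead_coeff p = 1"
    using assms unfolding algebraic_int_altdef_ipoly by blast
  define d where "d = degree p"
  have sum0: "(\<Sum>i<d. of_int (coeff p i) * x ^ i) + x ^ d = 0"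
    using p unfolding poly_of_int_eq_sum d_def by (simp flip: lessThan_Suc_atMost)
  \<comment> \<open>A monic polynomial of degree 0 is the constant 1 and has no root.\<close>
  then have "d > 0" by (cases d) auto
  moreover have "x ^ d = (\<Sum>i<d. of_int (- coeff p i) * x ^ i)"
    using sum0 by (simp add: sum_negf add_eq_0_iff)
  ultimately show ?thesis by (rule that)
qed

text \<open>Multiplication by \<open>x\<close> shifts the exponent, and only the top exponent
  \<open>d - 1\<close> calls for the relation. The cofactors \<open>W\<close> are arbitrary so that
  the lemma serves both for \<open>x\<close> with powers of \<open>y\<close> and for
  \<open>y\<close> with powers of \<open>x\<close>.\<close>

lemma lin_span_mult_closed:
  assumes "x ^ d = (\<Sum>i<d. of_int (c i) * x ^ i)" "d > 0" "finite W"
    and B: "B = (\<lambda>(i, w). x ^ i * w) ` ({..<d} \<times> W)"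
    and u: "u \<in> lin_span \<int> B"
  shows "x * u \<in> lin_span \<int> B"
proof -
  note sp = add_subgroup_lin_span[OF add_subgroup_Ints]
  have "finite B" using assms(3) by (simp add: B)
  note base = lin_span_base[OF add_subgroup_Ints Ints_1 this]
  have "x * b \<in> lin_span \<int> B" if "b \<in> B" for b
  proof -
    obtain i w where iw: "i < d" "w \<in> W" "b = x ^ i * w" using \<open>b \<in> B\<close> B by auto
    have mem: "x ^ j * w \<in> lin_span \<int> B" if "j < d" for j
      using that iw by (intro base) (auto simp: B)
    show ?thesis
    proof (cases "Suc i < d")
      case True
      then show ?thesis using mem[OF True] by (simp add: iw mult.assoc)
    next
      case False
      then have "Suc i = d" using iw by simp
      then have "x * b = x ^ d * w" by (auto simp: iw)
      also have "\<dots> = (\<Sum>i<d. of_int (c i) * (x ^ i * w))"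
        unfolding assms(1) by (simp add: sum_distrib_right mult.assoc)
      also have "\<dots> \<in> lin_span \<int> B"
        by (intro add_subgroup_sum[OF sp] add_subgroup_of_int_mult[OF sp] mem) auto
      finally show ?thesis .
    qed
  qed
  note mult_base = this
  obtain a where a: "\<forall>b\<in>B. a b \<in> \<int>" "u = (\<Sum>b\<in>B. a b * b)"
    using u unfolding lin_span_def by auto
  have "a b * (x * b) \<in> lin_span \<int> B" if "b \<in> B" for b
  proof -
    obtain m where "a b = of_int m" using a(1) \<open>b \<in> B\<close> by (metis Ints_cases)
    then show ?thesis using add_subgroup_of_int_mult[OF sp mult_base[OF that]] by simp
  qed
  then have "(\<Sum>b\<in>B. a b * (x * b)) \<in> lin_span \<int> B" by (rule add_subgroup_sum[OF sp])
  moreover have "x * u = (\<Sum>b\<in>B. a b * (x * b))"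
    unfolding a(2) sum_distrib_left by (rule sum.cong) simp_all
  ultimately show ?thesis by simp
qed

text \<open>The products \<open>x ^ i * y ^ j\<close> with bounded exponents span a group stable
  under both numbers, hence under \<open>x - y\<close> and \<open>x * y\<close>, to which
  \<open>algebraic_int_of_finite_module\<close> then applies.\<close>

lemma algebraic_int_common_module:
  assumes "algebraic_int (x::complex)" "algebraic_int y"
  obtains B where "finite B" "1 \<in> lin_span \<int> B"
    "\<And>u. u \<in> lin_span \<int> B \<Longrightarrow> x * u \<in> lin_span \<int> B"
    "\<And>u. u \<in> lin_span \<int> B \<Longrightarrow> y * u \<in> lin_span \<int> B"
proof -
  obtain d c where x: "d > 0" "x ^ d = (\<Sum>i<d. of_int (c i) * x ^ i)"
    using algebraic_int_power_reduce[OF assms(1)] .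
  obtain e a where y: "e > 0" "y ^ e = (\<Sum>i<e. of_int (a i) * y ^ i)"
    using algebraic_int_power_reduce[OF assms(2)] .
  define B where "B = (\<lambda>(i, j). x ^ i * y ^ j) ` ({..<d} \<times> {..<e})"
  have Bx: "B = (\<lambda>(i, w). x ^ i * w) ` ({..<d} \<times> (\<lambda>j. y ^ j) ` {..<e})"
    unfolding B_def by (force intro!: image_eqI)
  have By: "B = (\<lambda>(i, w). y ^ i * w) ` ({..<e} \<times> (\<lambda>j. x ^ j) ` {..<d})"
    unfolding B_def by (force intro!: image_eqI simp: mult.commute)
  have "1 \<in> B"
    unfolding B_def using x(1) y(1) by (intro image_eqI[of _ _ "(0, 0)"]) auto
  then have "1 \<in> lin_span \<int> B"
    by (intro lin_span_base[OF add_subgroup_Ints]) (auto simp: B_def)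
  moreover have "finite B" by (simp add: B_def)
  moreover have "x * u \<in> lin_span \<int> B" "y * u \<in> lin_span \<int> B" if "u \<in> lin_span \<int> B" for u
    using lin_span_mult_closed[OF x(2,1) _ Bx that] lin_span_mult_closed[OF y(2,1) _ By that]
    by (meson finite_imageI finite_lessThan)+
  ultimately show ?thesis using that by blast
qed

lemma algebraic_int_diff:
  assumes "algebraic_int (x::complex)" "algebraic_int y"
  shows "algebraic_int (x - y)"
proof -
  obtain B where B: "finite B" "1 \<in> lin_span \<int> B"
    "\<And>u. u \<in> lin_span \<int> B \<Longrightarrow> x * u \<in> lin_span \<int> B"
    "\<And>u. u \<in> lin_span \<int> B \<Longrightarrow> y * u \<in> lin_span \<int> B"
    using algebraic_int_common_module[OF assms] by metis
  show ?thesis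
    using B by (intro algebraic_int_of_finite_module[of B])
      (auto simp: left_diff_distrib
        intro: add_subgroup_diff[OF add_subgroup_lin_span[OF add_subgroup_Ints]])
qed

lemma algebraic_int_mult:
  assumes "algebraic_int (x::complex)" "algebraic_int y"
  shows "algebraic_int (x * y)"
proof -
  obtain B where B: "finite B" "1 \<in> lin_span \<int> B"
    "\<And>u. u \<in> lin_span \<int> B \<Longrightarrow> x * u \<in> lin_span \<int> B"
    "\<And>u. u \<in> lin_span \<int> B \<Longrightarrow> y * u \<in> lin_span \<int> B"
    using algebraic_int_common_module[OF assms] by metis
  show ?thesis
    using B by (intro algebraic_int_of_finite_module[of B]) (auto simp: mult.assoc)
qed

text \<open>Let \<open>l\<close> be the leading coefficient and d the degree of an integer
  polynomial with root \<open>x\<close>. Multiplying the equation by \<open>l ^ (d - 1)\<close>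
  turns it into a monic one for \<open>of_int l * x\<close>.\<close>

lemma algebraic_imp_integer_multiple:
  assumes "algebraic (x::complex)"
  obtains l :: int where "l \<noteq> 0" "algebraic_int (of_int l * x)"
proof -
  obtain p :: "complex poly" where p: "\<And>i. coeff p i \<in> \<int>" "p \<noteq> 0" "poly p x = 0"
    using assms by (rule algebraicE) blast
  have "\<forall>i. \<exists>a. coeff p i = of_int a" using p(1) by (meson Ints_cases)
  then obtain a where a: "\<And>i. coeff p i = of_int (a i)" by metis
  define d where "d = degree p"
  define l where "l = a d"
  have l0: "l \<noteq> 0" using p(2) a[of d] by (auto simp: l_def d_def)
  have "d > 0"
  proof (rule ccontr)
    assume "\<not> d > 0"
    then obtain c where "p = [:c:]" using degree_eq_zeroE[of p] by (auto simp: d_def)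
    then show False using p(2,3) by simp
  qed
  define z where "z = of_int l * x"
  \<comment> \<open>The top term stands apart: at i = d the exponent \<open>d - 1 - i\<close> is
    truncated to 0, and the formula would give the coefficient \<open>l\<close> instead of
    1.\<close>
  define r :: "complex poly" where
    "r = monom 1 d + (\<Sum>i<d. monom (of_int (a i * l ^ (d - 1 - i))) i)"
  have sum0: "(\<Sum>i<d. of_int (a i) * x ^ i) + of_int l * x ^ d = 0"
    using p(3) unfolding poly_altdef a l_def d_def lessThan_Suc_atMost[symmetric]
    by simp
  have "of_int (a i * l ^ (d - 1 - i)) * z ^ i = of_int l ^ (d - 1) * (of_int (a i) * x ^ i)"
    if "i < d" for i
  proof -
    have "d - 1 = (d - 1 - i) + i" using that by simp
    then have "(of_int l :: complex) ^ (d - 1) = of_int l ^ (d - 1 - i) * of_int l ^ i"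
      by (metis power_add)
    then show ?thesis by (simp add: z_def power_mult_distrib mult_ac)
  qed
  then have "(\<Sum>i<d. of_int (a i * l ^ (d - 1 - i)) * z ^ i) =
      of_int l ^ (d - 1) * (\<Sum>i<d. of_int (a i) * x ^ i)"
    unfolding sum_distrib_left by (intro sum.cong) auto
  then have "poly r z = z ^ d + of_int l ^ (d - 1) * (\<Sum>i<d. of_int (a i) * x ^ i)"
    unfolding r_def poly_add poly_sum poly_monom by simp
  also have "z ^ d = of_int l ^ (d - 1) * (of_int l * x ^ d)"
    using \<open>d > 0\<close> by (cases d) (auto simp: z_def power_mult_distrib)
  finally have "poly r z =
      of_int l ^ (d - 1) * ((\<Sum>i<d. of_int (a i) * x ^ i) + of_int l * x ^ d)"
    by (simp only: distrib_left add.commute)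
  then have "poly r z = 0" unfolding sum0 by simp
  moreover have "degree (\<Sum>i<d. monom (of_int (a i * l ^ (d - 1 - i)) :: complex) i) < d"
    using \<open>d > 0\<close> by (intro degree_sum_less) (auto intro: le_less_trans[OF degree_monom_le])
  then have "degree r = d" "coeff r d = 1"
    unfolding r_def by (auto simp: degree_add_eq_left degree_monom_eq coeff_eq_0)
  moreover have "coeff r i \<in> \<int>" for i
    unfolding r_def coeff_add coeff_sum by (intro Ints_add Ints_sum) auto
  ultimately have "algebraic_int z" by (intro algebraic_int.intros[of r]) auto
  then show ?thesis using l0 that by (simp add: z_def)
qed

text \<open>Since \<open>x\<close> is nonzero, factors \<open>x\<close> can be cancelled from the
  equation until the constant term is nonzero; up to sign that term is \<open>x\<close> times an
  integer polynomial in \<open>x\<close>.\<close>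

lemma poly_root_divides_int:
  fixes x :: complex
  assumes "x \<noteq> 0" "p \<noteq> 0" "poly (map_poly of_int p) x = 0"
  shows "\<exists>(N::int) q. N \<noteq> 0 \<and> of_int N = x * poly (map_poly of_int q) x"
  using assms(2,3)
proof (induction p)
  case 0
  then show ?case by simp
next
  case (pCons a p)
  have eq: "of_int a + x * poly (map_poly of_int p) x = 0"
    using pCons.prems(2) by (simp add: map_poly_pCons)
  show ?case
  proof (cases "a = 0")
    case True
    then show ?thesis using eq assms(1) pCons.IH pCons.prems(1) by auto
  next
    case False
    have "of_int (- a) = x * poly (map_poly of_int p) x"
      using eq by (simp add: add_eq_0_iff)
    then show ?thesis using False by (metis neg_equal_0_iff_equal)
  qed
qed

section \<open>Rings of integers and their ideals\<close>

definition complex_subring :: "complex set \<Rightarrow> bool" where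
  "complex_subring R \<longleftrightarrow> add_subgroup R \<and> 1 \<in> R \<and> (\<forall>x\<in>R. \<forall>y\<in>R. x * y \<in> R)"

lemma complex_subringD:
  assumes "complex_subring R"
  shows "add_subgroup R" "1 \<in> R" "\<And>x y. x \<in> R \<Longrightarrow> y \<in> R \<Longrightarrow> x * y \<in> R"
  using assms by (auto simp: complex_subring_def)

lemma complex_subring_prod:
  "complex_subring R \<Longrightarrow> (\<And>i. i \<in> S \<Longrightarrow> f i \<in> R) \<Longrightarrow> prod f S \<in> R"
  by (induction S rule: infinite_finite_induct) (auto intro: complex_subringD)

lemma complex_subring_power: "complex_subring R \<Longrightarrow> x \<in> R \<Longrightarrow> x ^ n \<in> R"
  using complex_subring_prod[of R "{..<n}" "\<lambda>_. x"] by simp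

lemma complex_subring_ring_of_integers:
  assumes "is_subfield k"
  shows "complex_subring (ring_of_integers k)"
proof -
  have "x - y \<in> k" if "x \<in> k" "y \<in> k" for x y
    using assms that unfolding is_subfield_def by (metis diff_conv_add_uminus)
  then show ?thesis
    using assms unfolding complex_subring_def add_subgroup_def ring_of_integers_def
    by (auto simp: is_subfield_def algebraic_integer_iff intro: algebraic_int_diff algebraic_int_mult)
qed

lemma of_int_in_subfield:
  assumes "is_subfield k"
  shows "of_int n \<in> k"
proof -
  have "x - y \<in> k" if "x \<in> k" "y \<in> k" for x y
    using assms that unfolding is_subfield_def by (metis diff_conv_add_uminus)
  then have "add_subgroup k" using assms by (auto simp: add_subgroup_def is_subfield_def)
  then show ?thesis
    using add_subgroup_of_int_mult[of k 1 n] assms by (simp add: is_subfield_def)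
qed

lemma ring_ideal_add_subgroup: "ring_ideal R I \<Longrightarrow> add_subgroup I"
  unfolding ring_ideal_def add_subgroup_def by (metis diff_conv_add_uminus)

lemma ring_ideal_mult: "ring_ideal R I \<Longrightarrow> r \<in> R \<Longrightarrow> x \<in> I \<Longrightarrow> r * x \<in> I"
  by (simp add: ring_ideal_def)

definition multiples :: "nat \<Rightarrow> complex set \<Rightarrow> complex set" where
  "multiples n R = (\<lambda>x. of_nat n * x) ` R"

lemma ring_ideal_multiples:
  assumes R: "complex_subring R"
  shows "ring_ideal R (multiples n R)"
proof -
  note a = complex_subringD[OF R]
  have "of_nat n * x + of_nat n * y \<in> multiples n R" if "x \<in> R" "y \<in> R" for x y
    using add_subgroup_add[OF a(1) that] by (auto simp: multiples_def simp flip: distrib_left)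
  moreover have "- (of_nat n * x) \<in> multiples n R" if "x \<in> R" for x
    using add_subgroup_uminus[OF a(1) that] unfolding multiples_def by (metis imageI mult_minus_right)
  moreover have "r * (of_nat n * x) \<in> multiples n R" if "r \<in> R" "x \<in> R" for r x
    using a(3)[OF that] unfolding multiples_def by (metis imageI mult.left_commute)
  moreover have "0 \<in> multiples n R"
    using add_subgroup_zero[OF a(1)] unfolding multiples_def by (metis imageI mult_zero_right)
  moreover have "multiples n R \<subseteq> R"
    using add_subgroup_of_nat_mult[OF a(1)] by (auto simp: multiples_def)
  ultimately show ?thesis
    unfolding ring_ideal_def by (auto simp: multiples_def)
qed

text \<open>The cofactor is an integer polynomial in \<open>x\<close>, so it stays in
  \<open>k\<close> without any recourse to conjugates; the factor \<open>sgn N\<close> makes the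
  multiple positive.\<close>

lemma algebraic_int_divides_nat:
  assumes k: "is_subfield k" and x: "x \<in> ring_of_integers k" "x \<noteq> 0"
  obtains n y where "n > 0" "y \<in> ring_of_integers k" "of_nat n = y * x"
proof -
  note R = complex_subringD[OF complex_subring_ring_of_integers[OF k]]
  obtain p where p: "lead_coeff p = 1" "poly (map_poly of_int p) x = 0"
    using x(1) by (auto simp: ring_of_integers_def algebraic_integer_def)
  then have "p \<noteq> 0" by auto
  then obtain N q where N: "N \<noteq> 0" "of_int N = x * poly (map_poly of_int q) x"
    using poly_root_divides_int[OF x(2) _ p(2)] by blast
  define y where "y = of_int (sgn N) * poly (map_poly of_int q) x"
  have "poly (map_poly of_int q) x \<in> ring_of_integers k"
    unfolding poly_of_int_eq_sum
    by (intro add_subgroup_sum add_subgroup_of_int_mult R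
        complex_subring_power complex_subring_ring_of_integers k x)
  then have "y \<in> ring_of_integers k" unfolding y_def by (intro add_subgroup_of_int_mult R)
  moreover have "of_nat (nat \<bar>N\<bar>) = y * x"
  proof -
    have "of_nat (nat \<bar>N\<bar>) = (of_int (sgn N * N) :: complex)"
      by (simp add: abs_if sgn_if)
    also have "\<dots> = y * x" by (simp add: y_def N(2) mult_ac)
    finally show ?thesis .
  qed
  moreover have "nat \<bar>N\<bar> > 0" using N by simp
  ultimately show ?thesis using that by blast
qed

lemma nonzero_ideal_contains_multiples:
  assumes k: "is_subfield k" and b: "ring_ideal (ring_of_integers k) b" "b \<noteq> {0}"
  obtains n where "n > 0" "multiples n (ring_of_integers k) \<subseteq> b"
proof -
  obtain x where x: "x \<in> b" "x \<noteq> 0" using b by (auto simp: ring_ideal_def)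
  then obtain n y where n: "n > 0" "y \<in> ring_of_integers k" "of_nat n = y * x"
    using algebraic_int_divides_nat[OF k, of x] b(1) by (auto simp: ring_ideal_def)
  have "(of_nat n :: complex) \<in> b" unfolding n(3) by (intro ring_ideal_mult[OF b(1)] n x)
  then have "multiples n (ring_of_integers k) \<subseteq> b"
    using ring_ideal_mult[OF b(1)] by (auto simp: multiples_def mult.commute)
  with n(1) show ?thesis by (rule that)
qed

text \<open>If \<open>x\<close> divides m > 0, then m + 1 cannot divide \<open>x\<close>: otherwise
  m / (m + 1) would be a rational algebraic integer strictly between 0 and 1.\<close>

lemma nonzero_not_multiple:
  assumes k: "is_subfield k" and x: "x \<in> ring_of_integers k" "x \<noteq> 0"
  obtains n where "n > 0" "x \<notin> multiples n (ring_of_integers k)"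
proof -
  note R = complex_subringD[OF complex_subring_ring_of_integers[OF k]]
  obtain m y where m: "m > 0" "y \<in> ring_of_integers k" "of_nat m = y * x"
    using algebraic_int_divides_nat[OF k x] .
  have "x \<notin> multiples (Suc m) (ring_of_integers k)"
  proof
    assume "x \<in> multiples (Suc m) (ring_of_integers k)"
    then obtain z where z: "z \<in> ring_of_integers k" "x = of_nat (Suc m) * z"
      by (auto simp: multiples_def)
    define r where "r = y * z"
    have eq: "of_nat m = of_nat (Suc m) * r" by (simp only: m(3) z(2) r_def mult_ac)
    have "r \<in> ring_of_integers k" unfolding r_def by (intro R m z)
    then have "algebraic_int r" by (simp add: ring_of_integers_def algebraic_integer_iff)
    moreover have "r = of_nat m / of_nat (Suc m)" using eq by (simp add: field_simps del: of_nat_Suc)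
    then have "r \<in> \<rat>" by simp
    ultimately obtain i where "r = of_int i"
      using rational_algebraic_int_is_int by (metis Ints_cases)
    with eq have "(of_int (int m) :: complex) = of_int (int (Suc m) * i)" by simp
    then have i: "int m = int (Suc m) * i" by (simp only: of_int_eq_iff)
    then have "i > 0" using m(1) by (metis of_nat_0_less_iff zero_less_mult_pos zero_less_Suc)
    then have "int (Suc m) * 1 \<le> int (Suc m) * i" by (intro mult_left_mono) auto
    with i show False by simp
  qed
  then show ?thesis using that by blast
qed

lemma finite_quotient_ring_of_integers:
  assumes "number_field k" "n > 0"
  shows "finite_quotient (ring_of_integers k) n"
proof -
  have k: "is_subfield k" using assms by (simp add: number_field_def)
  obtain B where B: "finite B" "\<forall>x\<in>k. \<exists>c :: complex \<Rightarrow> rat. x = (\<Sum>b\<in>B. of_rat (c b) * b)"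
    using assms by (auto simp: number_field_def)
  have "k \<subseteq> lin_span \<rat> B"
  proof
    fix x assume "x \<in> k"
    then obtain c :: "complex \<Rightarrow> rat" where "x = (\<Sum>b\<in>B. of_rat (c b) * b)" using B by blast
    then show "x \<in> lin_span \<rat> B"
      unfolding lin_span_def by (intro CollectI exI[of _ "\<lambda>b. of_rat (c b)"]) simp
  qed
  then show ?thesis
    by (intro finite_rank_finite_quotient[OF B(1)] assms
        complex_subringD[OF complex_subring_ring_of_integers[OF k]])
      (auto simp: ring_of_integers_def)
qed

section \<open>Congruences\<close>

text \<open>Telescoping: exchanging one factor at a time changes the product by an element of
  \<open>I\<close>, as the other factors lie in \<open>R\<close>.\<close>

lemma ring_ideal_prod_diff:
  assumes R: "complex_subring R" and I: "ring_ideal R I"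
    and "\<And>i. i \<in> S \<Longrightarrow> f i \<in> R" "\<And>i. i \<in> S \<Longrightarrow> g i \<in> R" "\<And>i. i \<in> S \<Longrightarrow> f i - g i \<in> I"
  shows "prod f S - prod g S \<in> I"
  using assms(3-5)
proof (induction S rule: infinite_finite_induct)
  case (insert x S)
  have "prod f S \<in> R" using insert.prems by (intro complex_subring_prod[OF R]) auto
  then have "prod f S * (f x - g x) + g x * (prod f S - prod g S) \<in> I"
    using insert by (intro add_subgroup_add[OF ring_ideal_add_subgroup[OF I]] ring_ideal_mult[OF I]) auto
  also have "prod f S * (f x - g x) + g x * (prod f S - prod g S) = prod f (insert x S) - prod g (insert x S)"
    using insert.hyps by (simp add: algebra_simps)
  finally show ?case .
qed (auto simp: add_subgroup_zero[OF ring_ideal_add_subgroup[OF I]])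

definition entries_in :: "complex set \<Rightarrow> 'n::finite mat \<Rightarrow> bool" where
  "entries_in R A \<longleftrightarrow> (\<forall>i j. A $ i $ j \<in> R)"

definition mat_cong :: "complex set \<Rightarrow> 'n::finite mat \<Rightarrow> 'n mat \<Rightarrow> bool" where
  "mat_cong I A B \<longleftrightarrow> entries_in I (A - B)"

lemma entries_in_mult:
  assumes "complex_subring R" "entries_in R A" "entries_in R B"
  shows "entries_in R (A ** B)"
  using assms unfolding entries_in_def matrix_matrix_mult_def
  by (auto intro!: add_subgroup_sum complex_subringD)

lemma det_in:
  assumes "complex_subring R" "entries_in R A"
  shows "det A \<in> R"
  using assms unfolding entries_in_def det_def
  by (auto intro!: add_subgroup_sum complex_subringD(1) add_subgroup_of_int_mult complex_subring_prod)

lemma det_cong: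
  assumes R: "complex_subring R" and I: "ring_ideal R I"
    and "entries_in R A" "entries_in R B" "mat_cong I A B"
  shows "det A - det B \<in> I"
  using assms(3-5) unfolding mat_cong_def entries_in_def det_def sum_subtractf[symmetric] right_diff_distrib[symmetric]
  by (intro add_subgroup_sum ring_ideal_add_subgroup[OF I] add_subgroup_of_int_mult
      ring_ideal_prod_diff[OF R I]) auto

lemma mat_cong_sym: "ring_ideal R I \<Longrightarrow> mat_cong I A B \<Longrightarrow> mat_cong I B A"
  unfolding mat_cong_def entries_in_def
  by (metis add_subgroup_uminus minus_diff_eq ring_ideal_add_subgroup vector_minus_component)

lemma mat_cong_refl: "ring_ideal R I \<Longrightarrow> mat_cong I A A"
  by (simp add: mat_cong_def entries_in_def ring_ideal_def)

lemma mat_cong_trans: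
  assumes "ring_ideal R I" "mat_cong I A B" "mat_cong I B C"
  shows "mat_cong I A C"
  unfolding mat_cong_def entries_in_def
proof (intro allI)
  fix i j
  have "(A - B) $ i $ j + (B - C) $ i $ j \<in> I"
    using assms(2,3) by (intro add_subgroup_add[OF ring_ideal_add_subgroup[OF assms(1)]])
      (auto simp: mat_cong_def entries_in_def)
  then show "(A - C) $ i $ j \<in> I" by simp
qed

lemma mat_cong_mult_left:
  assumes I: "ring_ideal R I" and "entries_in R C" "mat_cong I A B"
  shows "mat_cong I (C ** A) (C ** B)"
  using assms(2,3) unfolding mat_cong_def entries_in_def matrix_matrix_mult_def
  by (auto intro!: add_subgroup_sum ring_ideal_add_subgroup[OF I] ring_ideal_mult[OF I]
      simp: sum_subtractf[symmetric] right_diff_distrib[symmetric])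

lemma mat_cong_mult_right:
  assumes I: "ring_ideal R I" and "entries_in R C" "mat_cong I A B"
  shows "mat_cong I (A ** C) (B ** C)"
  using assms(2,3) unfolding mat_cong_def entries_in_def matrix_matrix_mult_def
  by (auto intro!: add_subgroup_sum ring_ideal_add_subgroup[OF I] ring_ideal_mult[OF I]
      simp: sum_subtractf[symmetric] right_diff_distrib[symmetric] mult.commute[of _ "C $ _ $ _"])

section \<open>Evaluation of polynomials\<close>

definition monomial_eval :: "('v \<Rightarrow>\<^sub>0 nat) \<Rightarrow> ('v \<Rightarrow> complex) \<Rightarrow> complex" where
  "monomial_eval m a = (\<Prod>v\<in>Poly_Mapping.keys m. a v ^ Poly_Mapping.lookup m v)"

text \<open>Brings several monomials to a common index set; the extra variables have exponent
  0.\<close>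

lemma monomial_eval_superset:
  assumes "finite T" "Poly_Mapping.keys m \<subseteq> T"
  shows "monomial_eval m a = (\<Prod>v\<in>T. a v ^ Poly_Mapping.lookup m v)"
  unfolding monomial_eval_def using assms
  by (intro prod.mono_neutral_left) (auto simp: in_keys_iff)

lemma monomial_eval_add: "monomial_eval (m + m') a = monomial_eval m a * monomial_eval m' a"
proof -
  let ?T = "Poly_Mapping.keys m \<union> Poly_Mapping.keys m'"
  have "monomial_eval (m + m') a = (\<Prod>v\<in>?T. a v ^ Poly_Mapping.lookup (m + m') v)"
    using Poly_Mapping.keys_add[of m m'] by (intro monomial_eval_superset) auto
  also have "\<dots> = (\<Prod>v\<in>?T. a v ^ Poly_Mapping.lookup m v) * (\<Prod>v\<in>?T. a v ^ Poly_Mapping.lookup m' v)"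
    by (simp add: lookup_add power_add prod.distrib)
  also have "\<dots> = monomial_eval m a * monomial_eval m' a"
    using monomial_eval_superset[of ?T] by simp
  finally show ?thesis .
qed

lemma mpoly_eval_superset:
  assumes "finite T" "Poly_Mapping.keys p \<subseteq> T"
  shows "mpoly_eval p a = (\<Sum>m\<in>T. Poly_Mapping.lookup p m * monomial_eval m a)"
  unfolding mpoly_eval_def monomial_eval_def[symmetric] using assms
  by (intro sum.mono_neutral_left) (auto simp: in_keys_iff)

lemma mpoly_eval_zero: "mpoly_eval 0 a = 0"
  by (simp add: mpoly_eval_def)

lemma mpoly_eval_add: "mpoly_eval (p + q) a = mpoly_eval p a + mpoly_eval q a"
proof -
  let ?T = "Poly_Mapping.keys p \<union> Poly_Mapping.keys q"
  have "mpoly_eval (p + q) a = (\<Sum>m\<in>?T. Poly_Mapping.lookup (p + q) m * monomial_eval m a)"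
    using Poly_Mapping.keys_add[of p q] by (intro mpoly_eval_superset) auto
  also have "\<dots> = (\<Sum>m\<in>?T. Poly_Mapping.lookup p m * monomial_eval m a)
      + (\<Sum>m\<in>?T. Poly_Mapping.lookup q m * monomial_eval m a)"
    by (simp add: lookup_add distrib_right sum.distrib)
  also have "\<dots> = mpoly_eval p a + mpoly_eval q a"
    using mpoly_eval_superset[of ?T] by simp
  finally show ?thesis .
qed

lemma mpoly_eval_single: "mpoly_eval (Poly_Mapping.single m c) a = c * monomial_eval m a"
  using mpoly_eval_superset[of "{m}" "Poly_Mapping.single m c" a] by simp

text \<open>Evaluation is additive, so peeling off single terms reduces its multiplicativity to that
  of monomials.\<close>

lemma poly_mapping_single_add_induct [case_names zero add]:
  assumes "P 0" "\<And>m c p. P p \<Longrightarrow> P (Poly_Mapping.single m c + p)"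
  shows "P (p :: 'a \<Rightarrow>\<^sub>0 'b::comm_monoid_add)"
proof (induction p rule: Poly_Mapping.update_induct)
  case const
  show ?case by (rule assms)
next
  case (update f a b)
  have "Poly_Mapping.update a b f = Poly_Mapping.single a b + f"
    using update(1) by (intro poly_mapping_eqI) (auto simp: lookup_update lookup_add lookup_single when_def in_keys_iff)
  then show ?case using assms(2) update by simp
qed

lemma mpoly_eval_single_mult:
  "mpoly_eval (Poly_Mapping.single m c * q) a = c * monomial_eval m a * mpoly_eval q a"
  by (induction q rule: poly_mapping_single_add_induct)
    (simp_all add: mpoly_eval_zero mpoly_eval_add mpoly_eval_single mult_single
      monomial_eval_add distrib_left mult_ac)

lemma mpoly_eval_mult: "mpoly_eval (p * q) a = mpoly_eval p a * mpoly_eval q a"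
  by (induction p rule: poly_mapping_single_add_induct)
    (simp_all add: mpoly_eval_zero mpoly_eval_add mpoly_eval_single mpoly_eval_single_mult
      distrib_right)

text \<open>The factor \<open>d\<close> clears the denominators of \<open>p\<close> and is kept
  outside the polynomial, so that no scaled polynomial has to be formed.\<close>

lemma scaled_mpoly_eval_in:
  assumes R: "complex_subring R" and "\<And>m. d * Poly_Mapping.lookup p m \<in> R" "\<And>v. a v \<in> R"
  shows "d * mpoly_eval p a \<in> R"
proof -
  have mono: "monomial_eval m a \<in> R" for m
    unfolding monomial_eval_def
    using assms(3) by (intro complex_subring_prod[OF R] complex_subring_power[OF R])
  show ?thesis
    unfolding mpoly_eval_def monomial_eval_def[symmetric] sum_distrib_left mult.assoc[symmetric]
    by (rule add_subgroup_sum[OF complex_subringD(1)[OF R]], rule complex_subringD(3)[OF R])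
      (use assms(2) mono in auto)
qed

lemma scaled_mpoly_eval_cong:
  assumes R: "complex_subring R" and I: "ring_ideal R I"
    and "\<And>m. d * Poly_Mapping.lookup p m \<in> R"
    and a: "\<And>v. a v \<in> R" "\<And>v. a' v \<in> R" "\<And>v. a v - a' v \<in> I"
  shows "d * mpoly_eval p a - d * mpoly_eval p a' \<in> I"
proof -
  have pw: "a v ^ n - a' v ^ n \<in> I" for v n
    using ring_ideal_prod_diff[OF R I, of "{..<n}" "\<lambda>_. a v" "\<lambda>_. a' v"] a by simp
  have "monomial_eval m a - monomial_eval m a' \<in> I" for m
    unfolding monomial_eval_def
    using a pw by (intro ring_ideal_prod_diff[OF R I] complex_subring_power[OF R]) auto
  then show ?thesis
    unfolding mpoly_eval_def monomial_eval_def[symmetric] sum_distrib_left mult.assoc[symmetric]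
      sum_subtractf[symmetric] right_diff_distrib[symmetric]
    using assms(3) by (intro add_subgroup_sum ring_ideal_add_subgroup[OF I] ring_ideal_mult[OF I])
qed

text \<open>Algebraicity gives each coefficient a denominator, and membership in \<open>k\<close>
  keeps the cleared coefficient in O_k. The support is finite, so the product of the denominators
  over it exists.\<close>

lemma common_denominator:
  assumes k: "is_subfield k" and p: "coeffs_in k p" "coeffs_in alg_closure p"
  obtains d :: int where "d \<noteq> 0" "\<And>m. of_int d * Poly_Mapping.lookup p m \<in> ring_of_integers k"
proof -
  note R = complex_subringD[OF complex_subring_ring_of_integers[OF k]]
  have "\<exists>l::int. l \<noteq> 0 \<and> of_int l * Poly_Mapping.lookup p m \<in> ring_of_integers k" for m
  proof -
    have "algebraic (Poly_Mapping.lookup p m)"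
      using p by (simp add: coeffs_in_def alg_closure_def)
    then obtain l :: int where "l \<noteq> 0" "algebraic_int (of_int l * Poly_Mapping.lookup p m)"
      by (rule algebraic_imp_integer_multiple)
    then show ?thesis
      using k p of_int_in_subfield[OF k, of l]
      by (auto simp: ring_of_integers_def algebraic_integer_iff coeffs_in_def is_subfield_def)
  qed
  then obtain l where l: "\<And>m. l m \<noteq> (0::int)"
    "\<And>m. of_int (l m) * Poly_Mapping.lookup p m \<in> ring_of_integers k"
    by metis
  define d where "d = (\<Prod>m\<in>Poly_Mapping.keys p. l m)"
  have "d \<noteq> 0" using l by (simp add: d_def)
  moreover have "of_int d * Poly_Mapping.lookup p m \<in> ring_of_integers k" for m
  proof (cases "m \<in> Poly_Mapping.keys p")
    case True
    then have "d = (\<Prod>m\<in>Poly_Mapping.keys p - {m}. l m) * l m"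
      unfolding d_def by (subst prod.remove[of _ m]) auto
    then have "of_int d * Poly_Mapping.lookup p m =
        of_int (\<Prod>m\<in>Poly_Mapping.keys p - {m}. l m) * (of_int (l m) * Poly_Mapping.lookup p m)"
      by (simp only: of_int_mult mult.assoc)
    then show ?thesis using add_subgroup_of_int_mult[OF R(1) l(2)] by metis
  next
    case False
    then show ?thesis using add_subgroup_zero[OF R(1)] by (simp add: in_keys_iff)
  qed
  ultimately show ?thesis using that by blast
qed

section \<open>Matrix groups\<close>

lemma matrix_inv_inverse:
  assumes "invertible (A :: 'n::finite mat)"
  shows "A ** matrix_inv A = mat 1" "matrix_inv A ** A = mat 1"
  using someI_ex[OF assms[unfolded invertible_def]] unfolding matrix_inv_def by auto

lemma matrix_inv_eqI:
  assumes "A ** B = mat 1" "B ** A = mat 1"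
  shows "matrix_inv (A :: 'n::finite mat) = B"
proof -
  have "invertible A" using assms by (auto simp: invertible_def)
  then have "matrix_inv A = matrix_inv A ** (A ** B)" using assms by simp
  also have "\<dots> = B"
    by (simp only: matrix_mul_assoc matrix_inv_inverse[OF \<open>invertible A\<close>] matrix_mul_lid)
  finally show ?thesis .
qed

lemma GL_over_iff:
  "A \<in> GL_over R \<longleftrightarrow> invertible A \<and> entries_in R A \<and> entries_in R (matrix_inv A)"
  by (auto simp: GL_over_def entries_in_def)

lemma invertible_matrix_inv: "invertible (A :: 'n::finite mat) \<Longrightarrow> invertible (matrix_inv A)"
  using matrix_inv_inverse unfolding invertible_def by blast

lemma matrix_inv_matrix_inv: "invertible (A :: 'n::finite mat) \<Longrightarrow> matrix_inv (matrix_inv A) = A"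
  by (rule matrix_inv_eqI) (simp_all add: matrix_inv_inverse)

lemma matrix_inv_mult:
  assumes "invertible (A :: 'n::finite mat)" "invertible (B :: 'n mat)"
  shows "matrix_inv (A ** B) = matrix_inv B ** matrix_inv A"
proof (rule matrix_inv_eqI)
  have "A ** B ** (matrix_inv B ** matrix_inv A) = A ** (B ** matrix_inv B) ** matrix_inv A"
    by (simp only: matrix_mul_assoc)
  then show "A ** B ** (matrix_inv B ** matrix_inv A) = mat 1"
    using assms by (simp add: matrix_inv_inverse)
  have "matrix_inv B ** matrix_inv A ** (A ** B) = matrix_inv B ** (matrix_inv A ** A) ** B"
    by (simp only: matrix_mul_assoc)
  then show "matrix_inv B ** matrix_inv A ** (A ** B) = mat 1"
    using assms by (simp add: matrix_inv_inverse)
qed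

lemma GL_over_mult:
  assumes R: "complex_subring R" and "A \<in> GL_over R" "B \<in> GL_over R"
  shows "A ** B \<in> GL_over R"
  using assms by (auto simp: GL_over_iff matrix_inv_mult invertible_mult intro: entries_in_mult)

lemma GL_over_matrix_inv: "A \<in> GL_over R \<Longrightarrow> matrix_inv A \<in> GL_over R"
  by (simp add: GL_over_iff invertible_matrix_inv matrix_inv_matrix_inv)

lemma mat_1_in_GL_over:
  assumes R: "complex_subring R"
  shows "(mat 1 :: 'n::finite mat) \<in> GL_over R"
proof -
  have "matrix_inv (mat 1 :: 'n mat) = mat 1" by (rule matrix_inv_eqI) simp_all
  moreover have "invertible (mat 1 :: 'n mat)" unfolding invertible_def by (intro exI[of _ "mat 1"]) simp
  moreover have "entries_in R (mat 1 :: 'n mat)"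
    using complex_subringD[OF R] add_subgroup_zero[of R] by (auto simp: entries_in_def mat_def)
  ultimately show ?thesis by (simp add: GL_over_iff)
qed

lemma matrix_subgroup_int_points:
  assumes "is_subfield k" "k_algebraic_group k G"
  shows "matrix_subgroup (int_points k G) (GL_over (ring_of_integers k))"
  using assms GL_over_mult[OF complex_subring_ring_of_integers]
    mat_1_in_GL_over[OF complex_subring_ring_of_integers] GL_over_matrix_inv
  unfolding k_algebraic_group_def int_points_def matrix_subgroup_def by auto

section \<open>Finite index subgroups of matrix groups\<close>

context
  fixes \<Gamma> :: "'n::finite mat set" and R
  assumes \<Gamma>: "matrix_subgroup \<Gamma> (GL_over R)"
begin

lemma matrix_subgroup_invertible: "A \<in> \<Gamma> \<Longrightarrow> invertible A"
  using \<Gamma> by (auto simp: matrix_subgroup_def GL_over_iff)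

lemma group_matgrp: "group (matgrp \<Gamma>)"
proof (rule groupI)
  fix x assume "x \<in> carrier (matgrp \<Gamma>)"
  then show "\<exists>y\<in>carrier (matgrp \<Gamma>). y \<otimes>\<^bsub>matgrp \<Gamma>\<^esub> x = \<one>\<^bsub>matgrp \<Gamma>\<^esub>"
    using \<Gamma> matrix_subgroup_invertible
    by (auto simp: matgrp_def matrix_subgroup_def matrix_inv_inverse intro!: bexI[of _ "matrix_inv x"])
qed (use \<Gamma> in \<open>auto simp: matgrp_def matrix_subgroup_def matrix_mul_assoc\<close>)

lemma m_inv_matgrp:
  assumes "A \<in> \<Gamma>"
  shows "inv\<^bsub>matgrp \<Gamma>\<^esub> A = matrix_inv A"
proof -
  interpret group "matgrp \<Gamma>" by (rule group_matgrp)
  show ?thesis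
    using assms \<Gamma> matrix_subgroup_invertible[OF assms]
    by (intro inv_equality) (auto simp: matgrp_def matrix_subgroup_def matrix_inv_inverse)
qed

lemma subgroup_matgrp_iff: "subgroup K (matgrp \<Gamma>) \<longleftrightarrow> matrix_subgroup K \<Gamma>"
proof
  assume K: "subgroup K (matgrp \<Gamma>)"
  have sub: "K \<subseteq> \<Gamma>" using subgroup.subset[OF K] by (simp add: matgrp_def)
  have "matrix_inv A \<in> K" if "A \<in> K" for A
    using subgroup.m_inv_closed[OF K that] m_inv_matgrp[of A] sub that by auto
  then show "matrix_subgroup K \<Gamma>"
    using sub subgroup.m_closed[OF K] subgroup.one_closed[OF K]
    by (auto simp: matrix_subgroup_def matgrp_def)
next
  assume K: "matrix_subgroup K \<Gamma>"
  then have "inv\<^bsub>matgrp \<Gamma>\<^esub> A \<in> K" if "A \<in> K" for A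
    using m_inv_matgrp[of A] that by (auto simp: matrix_subgroup_def)
  with K show "subgroup K (matgrp \<Gamma>)"
    by unfold_locales (auto simp: matrix_subgroup_def matgrp_def)
qed

lemma r_coset_matgrp: "K #>\<^bsub>matgrp \<Gamma>\<^esub> x = (\<lambda>y. y ** x) ` K"
  by (auto simp: r_coset_def matgrp_def)

text \<open>\<open>f\<close> need not be a homomorphism: if equal values force equal right cosets,
  there are at most as many cosets as values.\<close>

lemma finite_index_subgroupI:
  assumes K: "matrix_subgroup K \<Gamma>" and fin: "finite (f ` \<Gamma>)"
    and f: "\<And>x y. x \<in> \<Gamma> \<Longrightarrow> y \<in> \<Gamma> \<Longrightarrow> f x = f y \<Longrightarrow> x ** matrix_inv y \<in> K"
  shows "finite_index_subgroup K \<Gamma>"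
proof -
  let ?G = "matgrp \<Gamma>"
  interpret group ?G by (rule group_matgrp)
  have sg: "subgroup K ?G" using K by (simp add: subgroup_matgrp_iff)
  have eq: "K #>\<^bsub>?G\<^esub> x = K #>\<^bsub>?G\<^esub> y" if xy: "x \<in> \<Gamma>" "y \<in> \<Gamma>" "f x = f y" for x y
  proof (rule sym, rule repr_independence)
    have "x = (x ** matrix_inv y) ** y"
      using matrix_subgroup_invertible[OF xy(2)]
      by (simp add: matrix_inv_inverse flip: matrix_mul_assoc)
    then show "x \<in> K #>\<^bsub>?G\<^esub> y" using f[OF xy] unfolding r_coset_matgrp by blast
    show "y \<in> carrier ?G" using xy by (simp add: matgrp_def)
  qed (rule sg)
  \<comment> \<open>Choosing a point in each fibre of \<open>f\<close> makes the coset map factor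
    through \<open>f\<close>.\<close>
  define g where "g z = K #>\<^bsub>?G\<^esub> (SOME x. x \<in> \<Gamma> \<and> f x = z)" for z
  have "K #>\<^bsub>?G\<^esub> x = g (f x)" if "x \<in> \<Gamma>" for x
    unfolding g_def using someI[of "\<lambda>y. y \<in> \<Gamma> \<and> f y = f x" x] that by (intro eq) auto
  then have "rcosets\<^bsub>?G\<^esub> K \<subseteq> g ` f ` \<Gamma>"
    by (auto simp: RCOSETS_def matgrp_def)
  then show ?thesis
    using sg fin unfolding finite_index_subgroup_def by (auto intro: finite_subset)
qed

end

text \<open>Elements of \<open>\<Delta>\<close> in the same coset of \<open>K\<close> differ by an
  element of \<open>K \<inter> \<Delta>\<close>, so the coset of \<open>K\<close> serves as the
  invariant with finitely many values.\<close>

lemma finite_index_subgroup_Int: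
  assumes \<Gamma>: "matrix_subgroup \<Gamma> (GL_over R)" and \<Delta>: "matrix_subgroup \<Delta> (GL_over R)" "\<Delta> \<subseteq> \<Gamma>"
    and K: "finite_index_subgroup K \<Gamma>"
  shows "finite_index_subgroup (K \<inter> \<Delta>) \<Delta>"
proof -
  have sg: "subgroup K (matgrp \<Gamma>)" and fin: "finite (rcosets\<^bsub>matgrp \<Gamma>\<^esub> K)"
    using K by (auto simp: finite_index_subgroup_def)
  have mK: "matrix_subgroup K \<Gamma>" using sg subgroup_matgrp_iff[OF \<Gamma>] by simp
  show ?thesis
  proof (rule finite_index_subgroupI[OF \<Delta>(1), of _ "\<lambda>x. K #>\<^bsub>matgrp \<Gamma>\<^esub> x"])
    show "matrix_subgroup (K \<inter> \<Delta>) \<Delta>"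
      using mK \<Delta> by (auto simp: matrix_subgroup_def)
    show "finite ((\<lambda>x. K #>\<^bsub>matgrp \<Gamma>\<^esub> x) ` \<Delta>)"
      using fin by (rule finite_subset[rotated]) (use \<Delta> in \<open>auto simp: RCOSETS_def matgrp_def\<close>)
    fix x y assume xy: "x \<in> \<Delta>" "y \<in> \<Delta>" "K #>\<^bsub>matgrp \<Gamma>\<^esub> x = K #>\<^bsub>matgrp \<Gamma>\<^esub> y"
    have "mat 1 ** x \<in> K #>\<^bsub>matgrp \<Gamma>\<^esub> x"
      using mK unfolding r_coset_matgrp[OF \<Gamma>] matrix_subgroup_def by blast
    then obtain h where "h \<in> K" "x = h ** y"
      unfolding xy(3) unfolding r_coset_matgrp[OF \<Gamma>] by auto
    then have "x ** matrix_inv y \<in> K"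
      using matrix_inv_inverse[OF matrix_subgroup_invertible[OF \<Delta>(1) xy(2)]]
      by (simp flip: matrix_mul_assoc)
    moreover have "x ** matrix_inv y \<in> \<Delta>" using \<Delta>(1) xy by (auto simp: matrix_subgroup_def)
    ultimately show "x ** matrix_inv y \<in> K \<inter> \<Delta>" by simp
  qed
qed

section \<open>Congruence neighbourhoods of subgroups\<close>

text \<open>The difference of the inverses is
  \<open>matrix_inv A ** (B - A) ** matrix_inv B\<close>, whose outer factors have entries in
  \<open>R\<close>.\<close>

lemma mat_cong_matrix_inv:
  assumes I: "ring_ideal R I" and AB: "A \<in> GL_over R" "B \<in> GL_over R" "mat_cong I A B"
  shows "mat_cong I (matrix_inv A) (matrix_inv B)"
proof -
  have inv: "invertible A" "invertible B" "entries_in R (matrix_inv A)" "entries_in R (matrix_inv B)"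
    using AB by (auto simp: GL_over_iff)
  have "mat_cong I (matrix_inv A ** (A ** matrix_inv B)) (matrix_inv A ** (B ** matrix_inv B))"
    by (intro mat_cong_mult_left[OF I] mat_cong_mult_right[OF I] inv AB)
  then have "mat_cong I (matrix_inv B) (matrix_inv A)"
    using inv by (simp add: matrix_inv_inverse matrix_mul_assoc)
  then show ?thesis by (rule mat_cong_sym[OF I])
qed

lemma mat_cong_mult:
  assumes I: "ring_ideal R I" and "entries_in R A'" "entries_in R B"
    "mat_cong I A A'" "mat_cong I B B'"
  shows "mat_cong I (A ** B) (A' ** B')"
  using mat_cong_mult_right[OF I assms(3,4)] mat_cong_mult_left[OF I assms(2,5)]
  by (rule mat_cong_trans[OF I])

text \<open>This is the product of \<open>K\<close> with the principal congruence subgroup of level \<open>I\<close>.\<close>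
definition cong_nbhd :: "complex set \<Rightarrow> 'n::finite mat set \<Rightarrow> 'n mat set \<Rightarrow> 'n mat set" where
  "cong_nbhd I \<Gamma> K = {x \<in> \<Gamma>. \<exists>h\<in>K. mat_cong I x h}"

text \<open>Reducing the entries gives finitely many values. Matrices with equal reductions have a
  quotient congruent to the identity, which lies in the neighbourhood because
  \<open>mat 1 \<in> K\<close>; the index of \<open>K\<close> itself may be infinite.\<close>

lemma finite_index_cong_nbhd:
  fixes \<Gamma> :: "'n::finite mat set"
  assumes R: "complex_subring R" and n: "finite_quotient R n"
    and \<Gamma>: "matrix_subgroup \<Gamma> (GL_over R)" and K: "matrix_subgroup K \<Gamma>"
  shows "finite_index_subgroup (cong_nbhd (multiples n R) \<Gamma> K) \<Gamma>"
proof -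
  let ?I = "multiples n R"
  note I = ring_ideal_multiples[OF R, of n]
  have GL: "x \<in> GL_over R" "entries_in R x" if "x \<in> \<Gamma>" for x
    using \<Gamma> that by (auto simp: matrix_subgroup_def GL_over_iff)
  have KG: "x \<in> \<Gamma>" if "x \<in> K" for x using K that by (auto simp: matrix_subgroup_def)
  obtain F where F: "finite F" "F \<subseteq> R" "\<And>x. x \<in> R \<Longrightarrow> \<exists>f\<in>F. \<exists>y\<in>R. x = f + of_nat n * y"
    using n unfolding finite_quotient_def by metis
  have "\<exists>f\<in>F. x - f \<in> ?I" if "x \<in> R" for x
    using F(3)[OF that] by (force simp: multiples_def)
  then obtain r where r: "\<And>x. x \<in> R \<Longrightarrow> r x \<in> F" "\<And>x. x \<in> R \<Longrightarrow> x - r x \<in> ?I" by metis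
  define red where "red A = (\<lambda>(i, j). r (A $ i $ j))" for A :: "'n mat"
  show ?thesis
  proof (rule finite_index_subgroupI[OF \<Gamma>, of _ red])
    show "matrix_subgroup (cong_nbhd ?I \<Gamma> K) \<Gamma>"
      unfolding matrix_subgroup_def cong_nbhd_def
    proof (intro conjI ballI)
      show "mat 1 \<in> {x \<in> \<Gamma>. \<exists>h\<in>K. mat_cong ?I x h}"
        using K \<Gamma> mat_cong_refl[OF I, of "mat 1"] by (auto simp: matrix_subgroup_def)
      fix A assume "A \<in> {x \<in> \<Gamma>. \<exists>h\<in>K. mat_cong ?I x h}"
      then obtain h where A: "A \<in> \<Gamma>" "h \<in> K" "mat_cong ?I A h" by auto
      then show "matrix_inv A \<in> {x \<in> \<Gamma>. \<exists>h\<in>K. mat_cong ?I x h}"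
        using mat_cong_matrix_inv[OF I GL(1) GL(1) A(3)] KG K \<Gamma> by (auto simp: matrix_subgroup_def)
      fix B assume "B \<in> {x \<in> \<Gamma>. \<exists>h\<in>K. mat_cong ?I x h}"
      then obtain h' where B: "B \<in> \<Gamma>" "h' \<in> K" "mat_cong ?I B h'" by auto
      show "A ** B \<in> {x \<in> \<Gamma>. \<exists>h\<in>K. mat_cong ?I x h}"
        using mat_cong_mult[OF I GL(2) GL(2) A(3) B(3)] A B KG K \<Gamma>
        by (auto simp: matrix_subgroup_def)
    qed auto
    have "red ` \<Gamma> \<subseteq> (UNIV :: ('n \<times> 'n) set) \<rightarrow>\<^sub>E F"
      using r(1) GL(2) by (auto simp: red_def entries_in_def PiE_def)
    then show "finite (red ` \<Gamma>)"
      by (rule finite_subset) (intro finite_PiE finite_class.finite_UNIV F(1))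
    fix x y assume xy: "x \<in> \<Gamma>" "y \<in> \<Gamma>" "red x = red y"
    have "mat_cong ?I x y" unfolding mat_cong_def entries_in_def
    proof (intro allI)
      fix i j
      have R': "x $ i $ j \<in> R" "y $ i $ j \<in> R" using xy GL by (auto simp: entries_in_def)
      have "r (x $ i $ j) = r (y $ i $ j)" using fun_cong[OF xy(3), of "(i, j)"] by (simp add: red_def)
      then have "(x - y) $ i $ j = (x $ i $ j - r (x $ i $ j)) - (y $ i $ j - r (y $ i $ j))" by simp
      also have "\<dots> \<in> ?I"
        by (intro add_subgroup_diff ring_ideal_add_subgroup[OF I] r R')
      finally show "(x - y) $ i $ j \<in> ?I" .
    qed
    moreover have "matrix_inv y \<in> \<Gamma>" using xy \<Gamma> by (simp add: matrix_subgroup_def)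
    ultimately have "mat_cong ?I (x ** matrix_inv y) (y ** matrix_inv y)"
      by (intro mat_cong_mult_right[OF I] GL)
    then have "mat_cong ?I (x ** matrix_inv y) (mat 1)"
      using matrix_inv_inverse[OF matrix_subgroup_invertible[OF \<Gamma> xy(2)]] by simp
    moreover have "x ** matrix_inv y \<in> \<Gamma>" using xy \<Gamma> by (simp add: matrix_subgroup_def)
    ultimately show "x ** matrix_inv y \<in> cong_nbhd ?I \<Gamma> K"
      using K by (auto simp: cong_nbhd_def matrix_subgroup_def)
  qed
qed

lemma subset_cong_nbhd:
  assumes "ring_ideal R I" "K \<subseteq> \<Gamma>"
  shows "K \<subseteq> cong_nbhd I \<Gamma> K"
  using assms(2) mat_cong_refl[OF assms(1)] unfolding cong_nbhd_def by blast

text \<open>A congruence subgroup is a union of cosets of a principal one: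
  \<open>g = h ** (matrix_inv h ** g)\<close>, and the second factor is congruent to the identity
  when \<open>g\<close> is congruent to \<open>h\<close>.\<close>

lemma mat_cong_congruence_subgroup:
  assumes k: "is_subfield k" and H: "k_algebraic_group k H"
    and K: "congruence_subgroup k H K"
  obtains n where "n > 0"
    "\<And>g h. g \<in> int_points k H \<Longrightarrow> h \<in> K \<Longrightarrow> mat_cong (multiples n (ring_of_integers k)) g h \<Longrightarrow> g \<in> K"
proof -
  let ?R = "ring_of_integers k" and ?H = "int_points k H"
  note R = complex_subring_ring_of_integers[OF k]
  note Hg = matrix_subgroup_int_points[OF k H]
  obtain b where b: "ring_ideal ?R b" "b \<noteq> {0}" "principal_congruence k H b \<subseteq> K"
    using K by (auto simp: congruence_subgroup_def)
  have mK: "matrix_subgroup K ?H"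
    using K subgroup_matgrp_iff[OF Hg] by (simp add: congruence_subgroup_def)
  obtain n where n: "n > 0" "multiples n ?R \<subseteq> b"
    using nonzero_ideal_contains_multiples[OF k b(1,2)] .
  have "g \<in> K" if g: "g \<in> ?H" "h \<in> K" "mat_cong (multiples n ?R) g h" for g h
  proof -
    have h: "h \<in> ?H" "matrix_inv h \<in> K" "matrix_inv h \<in> ?H" "invertible h"
      using mK g(2) matrix_subgroup_invertible[OF Hg] by (auto simp: matrix_subgroup_def)
    have "mat_cong b g h" using g(3) n(2) by (auto simp: mat_cong_def entries_in_def)
    then have "mat_cong b (matrix_inv h ** g) (matrix_inv h ** h)"
      using Hg h(3) by (intro mat_cong_mult_left[OF b(1)]) (auto simp: matrix_subgroup_def GL_over_iff)
    then have "mat_cong b (matrix_inv h ** g) (mat 1)"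
      using h by (simp add: matrix_inv_inverse)
    moreover have "matrix_inv h ** g \<in> ?H" using Hg h g by (auto simp: matrix_subgroup_def)
    ultimately have "matrix_inv h ** g \<in> principal_congruence k H b"
      by (auto simp: principal_congruence_def mat_cong_def entries_in_def)
    then have "h ** (matrix_inv h ** g) \<in> K"
      using b(3) mK g(2) by (auto simp: matrix_subgroup_def)
    then show ?thesis using h by (simp add: matrix_mul_assoc matrix_inv_inverse)
  qed
  with n(1) show ?thesis by (rule that)
qed

section \<open>Separating a matrix from an algebraic subgroup by a congruence\<close>

lemma det_inverse:
  assumes "invertible (A :: 'n::finite mat)"
  shows "inverse (det A) = det (matrix_inv A)"
proof -
  have "det A * det (matrix_inv A) = 1"
    using matrix_inv_inverse[OF assms] by (simp flip: det_mul)
  then show ?thesis by (metis inverse_unique)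
qed

text \<open>The coordinate 1/det is the determinant of the inverse matrix, whose entries lie in
  \<open>R\<close> by the definition of \<open>GL_over\<close>.\<close>

lemma gl_coords_in:
  assumes "complex_subring R" "A \<in> GL_over R"
  shows "gl_coords A v \<in> R"
  using assms by (auto simp: gl_coords_def GL_over_iff det_inverse det_in entries_in_def split: option.split)

lemma gl_coords_cong:
  assumes R: "complex_subring R" and I: "ring_ideal R I"
    and AB: "A \<in> GL_over R" "B \<in> GL_over R" "mat_cong I A B"
  shows "gl_coords A v - gl_coords B v \<in> I"
  using AB mat_cong_matrix_inv[OF I AB] det_cong[OF R I, of "matrix_inv A" "matrix_inv B"]
  by (auto simp: gl_coords_def GL_over_iff det_inverse mat_cong_def entries_in_def split: option.split)

text \<open>Closedness gives a polynomial over the algebraic closure that vanishes on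
  \<open>H\<close> but not at \<open>g\<close>. If all generators over \<open>k\<close> vanished at
  \<open>g\<close>, so would the whole ideal; hence one of them separates as well.\<close>

lemma separating_polynomial:
  assumes k: "is_subfield k" and H: "k_algebraic_group k H" and g: "g \<in> GL_over alg_closure" "g \<notin> H"
  obtains p where "coeffs_in k p" "coeffs_in alg_closure p" "\<And>h. h \<in> H \<Longrightarrow> gl_eval p h = 0" "gl_eval p g \<noteq> 0"
proof -
  obtain S where S: "\<forall>p\<in>S. coeffs_in k p" "vanishing_ideal H = poly_ideal_gen alg_closure S"
    using H by (auto simp: k_algebraic_group_def)
  obtain T where T: "\<forall>p\<in>T. coeffs_in alg_closure p"
      "H = {A \<in> GL_over alg_closure. \<forall>p\<in>T. gl_eval p A = 0}"
    using H by (auto simp: k_algebraic_group_def zariski_closed_GL_def)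
  obtain q where q: "q \<in> T" "gl_eval q g \<noteq> 0" using g T by auto
  then have "q \<in> vanishing_ideal H" using T by (auto simp: vanishing_ideal_def)
  then have "q \<in> poly_ideal_gen alg_closure S" using S by simp
  then have "\<exists>p\<in>S. gl_eval p g \<noteq> 0"
    using q(2)
    by induction (auto simp: gl_eval_def mpoly_eval_zero mpoly_eval_add mpoly_eval_mult,
        metis add.right_neutral)
  then obtain p where p: "p \<in> S" "gl_eval p g \<noteq> 0" by blast
  \<comment> \<open>The rule for generators only yields products, so \<open>p\<close> itself enters
    the ideal as \<open>1 * p\<close>.\<close>
  have "coeffs_in alg_closure (1 :: 'a gl_poly)"
    by (auto simp: coeffs_in_def alg_closure_def lookup_one when_def)
  then have "1 * p \<in> vanishing_ideal H" using p(1) S(2) by (metis poly_ideal_gen.gen)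
  then show ?thesis using that p S(1) by (auto simp: vanishing_ideal_def)
qed

lemma mat_cong_int_points:
  assumes k: "is_subfield k" and H: "k_algebraic_group k H"
    and g: "g \<in> GL_over alg_closure" "g \<in> GL_over (ring_of_integers k)" "g \<notin> H"
  obtains n where "n > 0" "\<And>h. h \<in> int_points k H \<Longrightarrow> \<not> mat_cong (multiples n (ring_of_integers k)) g h"
proof -
  let ?R = "ring_of_integers k"
  note R = complex_subring_ring_of_integers[OF k]
  obtain p where p: "coeffs_in k p" "coeffs_in alg_closure p" "\<And>h. h \<in> H \<Longrightarrow> gl_eval p h = 0"
    "gl_eval p g \<noteq> 0"
    using separating_polynomial[OF k H g(1,3)] by metis
  obtain d :: int where d: "d \<noteq> 0" "\<And>m. of_int d * Poly_Mapping.lookup p m \<in> ?R"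
    using common_denominator[OF k p(1,2)] by metis
  have "of_int d * gl_eval p g \<in> ?R"
    unfolding gl_eval_def by (intro scaled_mpoly_eval_in[OF R] d gl_coords_in[OF R] g)
  then obtain n where n: "n > 0" "of_int d * gl_eval p g \<notin> multiples n ?R"
    using nonzero_not_multiple[OF k] d(1) p(4) by (metis mult_eq_0_iff of_int_eq_0_iff)
  have "\<not> mat_cong (multiples n ?R) g h" if h: "h \<in> int_points k H" for h
  proof
    assume cong: "mat_cong (multiples n ?R) g h"
    have "of_int d * gl_eval p g - of_int d * gl_eval p h \<in> multiples n ?R"
      unfolding gl_eval_def
      by (intro scaled_mpoly_eval_cong[OF R ring_ideal_multiples[OF R]] d gl_coords_in[OF R]
          gl_coords_cong[OF R ring_ideal_multiples[OF R]] g cong)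
        (use h in \<open>auto simp: int_points_def\<close>)
    then show False using p(3)[of h] h n(2) by (simp add: int_points_def)
  qed
  with n(1) show ?thesis by (rule that)
qed

section \<open>Ascent to the larger group, and the equivalence\<close>

lemma separable_in_overgroup:
  assumes k: "number_field k" and G: "k_algebraic_group k G" and H: "k_algebraic_group k H"
    and HG: "H \<subseteq> G"
    and csp: "\<forall>K. finite_index_subgroup K (int_points k H) \<longrightarrow> congruence_subgroup k H K"
    and L: "subgroup L (matgrp (int_points k H))" and sep: "separable_in L (int_points k H)"
  shows "separable_in L (int_points k G)"
  unfolding separable_in_def
proof
  let ?R = "ring_of_integers k" and ?H = "int_points k H" and ?G = "int_points k G"
  have k': "is_subfield k" using k by (simp add: number_field_def)
  note R = complex_subring_ring_of_integers[OF k']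
  note Hg = matrix_subgroup_int_points[OF k' H] and Gg = matrix_subgroup_int_points[OF k' G]
  have sub: "?H \<subseteq> ?G" using HG by (auto simp: int_points_def)
  have mL: "matrix_subgroup L ?H" using L subgroup_matgrp_iff[OF Hg] by simp
  fix g assume g: "g \<in> ?G - L"
  \<comment> \<open>Finite index is not asked of \<open>K\<close>: the congruence neighbourhood
    supplies it later, which lets the second case take \<open>L\<close> itself.\<close>
  have "\<exists>n K. n > 0 \<and> matrix_subgroup K ?H \<and> L \<subseteq> K \<and> (\<forall>h\<in>K. \<not> mat_cong (multiples n ?R) g h)"
  proof (cases "g \<in> H")
    case True
    then have gH: "g \<in> ?H" using g by (simp add: int_points_def)
    then obtain K where K: "finite_index_subgroup K ?H" "L \<subseteq> K" "g \<notin> K"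
      using sep g by (auto simp: separable_in_def)
    have mK: "matrix_subgroup K ?H"
      using K(1) subgroup_matgrp_iff[OF Hg] by (simp add: finite_index_subgroup_def)
    have "congruence_subgroup k H K" using csp K(1) by simp
    then obtain n where "n > 0" and
      n: "\<And>g h. g \<in> ?H \<Longrightarrow> h \<in> K \<Longrightarrow> mat_cong (multiples n ?R) g h \<Longrightarrow> g \<in> K"
      by (rule mat_cong_congruence_subgroup[OF k' H]) (rule that)
    moreover have "\<forall>h\<in>K. \<not> mat_cong (multiples n ?R) g h" using n[OF gH] K(3) by auto
    ultimately show ?thesis using mK K(2) by (intro exI[of _ n] exI[of _ K] conjI)
  next
    case False
    have gl: "g \<in> GL_over alg_closure" "g \<in> GL_over ?R"
      using g G by (auto simp: int_points_def k_algebraic_group_def matrix_subgroup_def)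
    obtain n where n: "n > 0" "\<And>h. h \<in> ?H \<Longrightarrow> \<not> mat_cong (multiples n ?R) g h"
      by (rule mat_cong_int_points[OF k' H gl False]) (rule that)
    have "\<forall>h\<in>L. \<not> mat_cong (multiples n ?R) g h"
      using n(2) mL by (auto simp: matrix_subgroup_def)
    then show ?thesis using n(1) mL by (intro exI[of _ n] exI[of _ L] conjI) auto
  qed
  then obtain n K where K: "n > 0" "matrix_subgroup K ?H" "L \<subseteq> K"
    "\<forall>h\<in>K. \<not> mat_cong (multiples n ?R) g h" by blast
  have mK: "matrix_subgroup K ?G" using K(2) sub by (auto simp: matrix_subgroup_def)
  have "finite_index_subgroup (cong_nbhd (multiples n ?R) ?G K) ?G"
    by (intro finite_index_cong_nbhd R finite_quotient_ring_of_integers k K Gg mK)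
  moreover have "L \<subseteq> cong_nbhd (multiples n ?R) ?G K"
    using subset_cong_nbhd[OF ring_ideal_multiples[OF R], of K ?G n] K(3) mK
    by (auto simp: matrix_subgroup_def)
  moreover have "g \<notin> cong_nbhd (multiples n ?R) ?G K"
    using K(4) by (auto simp: cong_nbhd_def)
  ultimately show "\<exists>K. finite_index_subgroup K ?G \<and> L \<subseteq> K \<and> g \<notin> K" by blast
qed

theorem mainTheorem11:
  fixes k :: "complex set" and G H :: "'n::finite mat set"
  assumes "number_field k"
    and "k_algebraic_group k G"
    and "k_algebraic_group k H"
    and "H \<subseteq> G"
    and "\<forall>K. finite_index_subgroup K (int_points k H) \<longrightarrow> congruence_subgroup k H K"
    and "subgroup L (matgrp (int_points k H))"
  shows "separable_in L (int_points k H) \<longleftrightarrow> separable_in L (int_points k G)"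
proof
  assume "separable_in L (int_points k H)"
  then show "separable_in L (int_points k G)" by (rule separable_in_overgroup[OF assms])
next
  assume sep: "separable_in L (int_points k G)"
  have k: "is_subfield k" using assms(1) by (simp add: number_field_def)
  have sub: "int_points k H \<subseteq> int_points k G" using assms(4) by (auto simp: int_points_def)
  have L: "L \<subseteq> int_points k H" using subgroup.subset[OF assms(6)] by (simp add: matgrp_def)
  show "separable_in L (int_points k H)"
    unfolding separable_in_def
  proof
    fix g assume g: "g \<in> int_points k H - L"
    then obtain K where "finite_index_subgroup K (int_points k G)" "L \<subseteq> K" "g \<notin> K"
      using sep sub unfolding separable_in_def by blast
    \<comment> \<open>Intersecting \<open>K\<close> with H(O_k) keeps the index finite, and
      \<open>L\<close> survives because it lies in H(O_k).\<close>
    then show "\<exists>K. finite_index_subgroup K (int_points k H) \<and> L \<subseteq> K \<and> g \<notin> K"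
      using L sub finite_index_subgroup_Int[OF matrix_subgroup_int_points[OF k assms(2)]
          matrix_subgroup_int_points[OF k assms(3)]]
      by (intro exI[of _ "K \<inter> int_points k H"]) auto
  qed
qed

end
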